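(* Let $D$ be a digraph whose unique strong component with more than one vertex, $D'$, is a subdivision of a vault without a niche, with walls $P_0,\dots,P_{\ell-1}$ of $D'$ as in the context. Let $u\neq v$ be vertices of $D'$ with a common external neighbor $\alpha$. Then (i) $(\{u,v\},\alpha)$ is a pin if and only if $\{u,v\}$ is a dicycle transversal of $D'$; and (ii) $(\{u,v\},\alpha)$ is not a pin if and only if $(\{u,v\},\alpha)$ is a $1$-clasp.
   Context: Digraphs are finite, loops and multiple arcs allowed; a dicycle is a directed cycle, a cycle is a cycle of $\mathrm{UG}(D)$; a dicycle transversal of $D'$ is a set $S$ with $D'-S$ acyclic. External vertices are those of $V(D)\setminus V(D')$; neighbors are taken in $\mathrm{UG}(D)$. Vault: $\ell\ge 5$ odd, $P_0,\dots,P_{\ell-1}$ disjoint nonempty dipaths, $a_i$ initial and $d_i$ terminal vertex of $P_i$, $b_i,c_i\in V(P_i)$ with either $b_ic_i$ an arc of $P_i$ or $b_i=c_i\in\{a_i,d_i\}$; the vault is obtained from the disjoint union of the $P_i$ by adding, for every $i$ (indices mod $\ell$), at least one arc from some vertex of $P_i[c_i,d_i]$ to some vertex of $P_{i+1}[a_{i+1},b_{i+1}]$ (multiple arcs allowed) and a single arc $d_ia_{i+2}$, and no further arcs. It has a niche if there are arcs $pq,rs$ from some $P_i$ to $P_{i+1}$ with $p$ before $r$ on $P_i$ and $q$ after $s$ on $P_{i+1}$. In the subdivision $D'$, each arc $pq$ of the vault is replaced by a $(p,q)$-dipath with new internal vertices, called a link. The wall $P_i$ of $D'$ is the dipath formed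 by the subdivided wall $P_i$ followed by the link of $d_ia_{i+2}$ minus $a_{i+2}$; $a_i,d_i$ are its first and last vertex; links of arcs from $P_i$ to $P_{i+1}$ are called links from $P_i$ to $P_{i+1}$. $P[x,y]$, $P(x,y]$, $P[x,y)$ denote subpaths (with the marked end omitted). Let $b_i'$ be the last vertex of $P_i$ which is the end of a link starting in $P_{i-1}$, and $c_i'$ the first vertex of $P_i$ which is the start of a link ending in $P_{i+1}$. The pair $(\{u,v\},\alpha)$ is a pin if $\alpha$ is external, $u,v$ are neighbors of $\alpha$, and the two vertices can be named $x,y$ (so $\{x,y\}=\{u,v\}$) such that for some $i$, $x\in P_i[b_i',d_i]$, $y\in P_{i+1}[a_{i+1},c_{i+1}']$, and there is no link from a vertex $p\in P_i[a_i,x)$ to a vertex $q\in P_{i+1}(y,d_{i+1}]$. For $k\ge1$, $(\{u,v\},\alpha)$ is a $k$-clasp if $\alpha$ is external, $u,v$ are neighbors of $\alpha$, and there is a cycle $C^*$ in $\mathrm{UG}(D)$ containing $u,v,\alpha$ and at most $k$ external vertices and a dicycle $B^*$ of $D$ with $V(B^* )\cap V(C^* )=\emptyset$.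
   Formalization: Loops are allowed as arcs but do not count as dicycles (a dicycle has length at least 2); otherwise a loop at an external vertex other than α would make a pin also a 1-clasp, so (ii) would fail. *)

theory Defs
  imports "Graph_Theory.Graph_Theory"
begin

section \<open>Cycles, neighbors and transversals\<close>

text \<open>
  Loops are allowed as arcs but are not counted as dicycles or cycles; these have length at
  least 2 (antiparallel and parallel arcs do form cycles of length 2). Subdivisions of vaults
  are loopless, so the convention only matters for loops at external vertices, each of which is
  a strong component with a single vertex.
\<close>

definition dicycle :: "('a, 'b) pre_digraph \<Rightarrow> 'b awalk \<Rightarrow> bool" where
  "dicycle G p \<longleftrightarrow> pre_digraph.cycle G p \<and> 2 \<le> length p"

text \<open>
  A cycle of the underlying undirected multigraph, given by its cyclic sequences of vertices
  and of arcs (traversed in either direction). Library notions of underlying graph merge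
  parallel arcs, or treat going back and forth along an edge as a cycle.
\<close>

definition ug_cycle :: "('a, 'b) pre_digraph \<Rightarrow> 'a list \<Rightarrow> 'b list \<Rightarrow> bool" where
  "ug_cycle G vs es \<longleftrightarrow>
     2 \<le> length vs \<and> length es = length vs \<and> distinct vs \<and> distinct es \<and>
     set vs \<subseteq> verts G \<and> set es \<subseteq> arcs G \<and>
     (\<forall>j < length vs. {tail G (es ! j), head G (es ! j)} = {vs ! j, vs ! (Suc j mod length vs)})"

definition ug_neighbor :: "('a, 'b) pre_digraph \<Rightarrow> 'a \<Rightarrow> 'a \<Rightarrow> bool" where
  "ug_neighbor G x y \<longleftrightarrow> (\<exists>e \<in> arcs G. {tail G e, head G e} = {x, y})"

definition dicycle_transversal :: "('a, 'b) pre_digraph \<Rightarrow> 'a set \<Rightarrow> bool" where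
  "dicycle_transversal G S \<longleftrightarrow> \<not> (\<exists>p. dicycle (G \<restriction> (verts G - S)) p)"


section \<open>Positions on a path\<close>

definition before :: "'a list \<Rightarrow> 'a \<Rightarrow> 'a \<Rightarrow> bool" where
  "before xs x y \<longleftrightarrow> (\<exists>j k. j < k \<and> k < length xs \<and> xs ! j = x \<and> xs ! k = y)"

definition subpath :: "'a list \<Rightarrow> 'a \<Rightarrow> 'a \<Rightarrow> 'a set" where
  "subpath xs x y = {z \<in> set xs. (z = x \<or> before xs x z) \<and> (z = y \<or> before xs z y)}"


section \<open>Vaults\<close>

text \<open>
  The \<open>i\<close>-th wall is the dipath that starts in \<open>wall_first V i\<close> and has the arc sequence
  \<open>wall_arcs V i\<close>, which is empty if the wall is a single vertex.
  Indices range over \<open>{..<num_walls V}\<close> and are read modulo \<open>num_walls V\<close>.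
\<close>

record ('a, 'c) vault_structure =
  vault_graph :: "('a, 'c) pre_digraph"
  num_walls :: nat
  wall_first :: "nat \<Rightarrow> 'a"
  wall_arcs :: "nat \<Rightarrow> 'c awalk"
  wall_b :: "nat \<Rightarrow> 'a"
  wall_c :: "nat \<Rightarrow> 'a"

definition wall_verts :: "('a, 'c) vault_structure \<Rightarrow> nat \<Rightarrow> 'a list" where
  "wall_verts V i = pre_digraph.awalk_verts (vault_graph V) (wall_first V i) (wall_arcs V i)"

definition wall_last :: "('a, 'c) vault_structure \<Rightarrow> nat \<Rightarrow> 'a" where
  "wall_last V i = last (wall_verts V i)"

definition step :: "('a, 'c) vault_structure \<Rightarrow> nat \<Rightarrow> nat \<Rightarrow> nat" where
  "step V k i = (i + k) mod num_walls V"

definition cross_arcs :: "('a, 'c) vault_structure \<Rightarrow> nat \<Rightarrow> 'c set" where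
  "cross_arcs V i = {e \<in> arcs (vault_graph V).
     tail (vault_graph V) e \<in> set (wall_verts V i) \<and>
     head (vault_graph V) e \<in> set (wall_verts V (step V 1 i))}"

text \<open>The arcs from \<open>P\<^sub>i[c\<^sub>i, d\<^sub>i]\<close> to \<open>P\<^sub>i\<^sub>+\<^sub>1[a\<^sub>i\<^sub>+\<^sub>1, b\<^sub>i\<^sub>+\<^sub>1]\<close>.\<close>

definition admissible_arcs :: "('a, 'c) vault_structure \<Rightarrow> nat \<Rightarrow> 'c set" where
  "admissible_arcs V i = {e \<in> arcs (vault_graph V).
     tail (vault_graph V) e \<in> subpath (wall_verts V i) (wall_c V i) (wall_last V i) \<and>
     head (vault_graph V) e \<in>
       subpath (wall_verts V (step V 1 i)) (wall_first V (step V 1 i)) (wall_b V (step V 1 i))}"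

text \<open>The arcs from \<open>d\<^sub>i\<close> to \<open>a\<^sub>i\<^sub>+\<^sub>2\<close>.\<close>

definition skip_arcs :: "('a, 'c) vault_structure \<Rightarrow> nat \<Rightarrow> 'c set" where
  "skip_arcs V i = {e \<in> arcs (vault_graph V).
     tail (vault_graph V) e = wall_last V i \<and>
     head (vault_graph V) e = wall_first V (step V 2 i)}"

locale vault =
  fixes V :: "('a, 'c) vault_structure"
  assumes fin: "fin_digraph (vault_graph V)"
    and num_walls: "5 \<le> num_walls V" "odd (num_walls V)"
    and wall_path: "i < num_walls V \<Longrightarrow>
      pre_digraph.apath (vault_graph V) (wall_first V i) (wall_arcs V i) (wall_last V i)"
    and walls_disjoint: "i < num_walls V \<Longrightarrow> j < num_walls V \<Longrightarrow> i \<noteq> j \<Longrightarrow>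
      set (wall_verts V i) \<inter> set (wall_verts V j) = {}"
    and wall_bc: "i < num_walls V \<Longrightarrow>
      (\<exists>e \<in> set (wall_arcs V i).
         tail (vault_graph V) e = wall_b V i \<and> head (vault_graph V) e = wall_c V i) \<or>
      (wall_b V i = wall_c V i \<and> wall_b V i \<in> {wall_first V i, wall_last V i})"
    and admissible_arcs: "i < num_walls V \<Longrightarrow> admissible_arcs V i \<noteq> {}"
    and skip_arcs: "i < num_walls V \<Longrightarrow> \<exists>!e. e \<in> skip_arcs V i"
    and verts: "verts (vault_graph V) = (\<Union>i < num_walls V. set (wall_verts V i))"
    and arcs: "arcs (vault_graph V) =
      (\<Union>i < num_walls V. set (wall_arcs V i) \<union> admissible_arcs V i \<union> skip_arcs V i)"

definition has_niche :: "('a, 'c) vault_structure \<Rightarrow> bool" where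
  "has_niche V \<longleftrightarrow> (\<exists>i < num_walls V. \<exists>e \<in> cross_arcs V i. \<exists>f \<in> cross_arcs V i.
     before (wall_verts V i) (tail (vault_graph V) e) (tail (vault_graph V) f) \<and>
     before (wall_verts V (step V 1 i)) (head (vault_graph V) f) (head (vault_graph V) e))"


section \<open>Subdivisions\<close>

text \<open>
  \<open>G\<close> arises from \<open>H\<close> by replacing each arc \<open>e\<close> of \<open>H\<close> by the dipath with arc sequence \<open>L e\<close>,
  its link. The vertices of \<open>H\<close> are kept. Unlike the library's notion of subdivision, this
  does not require the digraphs to be bidirected.
\<close>

definition subdivision_via ::
    "('a, 'c) pre_digraph \<Rightarrow> ('c \<Rightarrow> 'b awalk) \<Rightarrow> ('a, 'b) pre_digraph \<Rightarrow> bool" where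
  "subdivision_via H L G \<longleftrightarrow>
     wf_digraph H \<and> wf_digraph G \<and>
     (\<forall>e \<in> arcs H. L e \<noteq> [] \<and> pre_digraph.awalk G (tail H e) (L e) (head H e) \<and>
        distinct (pre_digraph.inner_verts G (L e)) \<and>
        set (pre_digraph.inner_verts G (L e)) \<inter> verts H = {}) \<and>
     (\<forall>e \<in> arcs H. \<forall>f \<in> arcs H. e \<noteq> f \<longrightarrow> set (L e) \<inter> set (L f) = {} \<and>
        set (pre_digraph.inner_verts G (L e)) \<inter> set (pre_digraph.inner_verts G (L f)) = {}) \<and>
     verts G = verts H \<union> (\<Union>e \<in> arcs H. set (pre_digraph.inner_verts G (L e))) \<and>
     arcs G = (\<Union>e \<in> arcs H. set (L e))"

text \<open>
  The vertex sequence of the \<open>i\<close>-th wall of the subdivision \<open>G\<close>: the subdivided wall of the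
  vault followed by the link of \<open>d\<^sub>ia\<^sub>i\<^sub>+\<^sub>2\<close>, without the final vertex \<open>a\<^sub>i\<^sub>+\<^sub>2\<close>.
\<close>

definition sub_wall ::
    "('a, 'c) vault_structure \<Rightarrow> ('c \<Rightarrow> 'b awalk) \<Rightarrow> ('a, 'b) pre_digraph \<Rightarrow> nat \<Rightarrow> 'a list" where
  "sub_wall V L G i = butlast (pre_digraph.awalk_verts G (wall_first V i)
     (concat (map L (wall_arcs V i @ [THE e. e \<in> skip_arcs V i]))))"

text \<open>
  The links from \<open>P\<^sub>i\<close> to \<open>P\<^sub>i\<^sub>+\<^sub>1\<close> are those of the arcs in \<open>cross_arcs V i\<close>, and a link starts
  and ends at the tail and the head of its arc. For \<open>b\<^sub>i'\<close>, the index \<open>i - 1\<close> is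
  written as \<open>i + (\<ell> - 1)\<close>.
\<close>

definition sub_b ::
    "('a, 'c) vault_structure \<Rightarrow> ('c \<Rightarrow> 'b awalk) \<Rightarrow> ('a, 'b) pre_digraph \<Rightarrow> nat \<Rightarrow> 'a" where
  "sub_b V L G i = last (filter
     (\<lambda>x. x \<in> head (vault_graph V) ` cross_arcs V (step V (num_walls V - 1) i)) (sub_wall V L G i))"

definition sub_c ::
    "('a, 'c) vault_structure \<Rightarrow> ('c \<Rightarrow> 'b awalk) \<Rightarrow> ('a, 'b) pre_digraph \<Rightarrow> nat \<Rightarrow> 'a" where
  "sub_c V L G i = hd (filter
     (\<lambda>x. x \<in> tail (vault_graph V) ` cross_arcs V i) (sub_wall V L G i))"


section \<open>Pins and clasps\<close>

definition pin ::
    "('a, 'c) vault_structure \<Rightarrow> ('c \<Rightarrow> 'b awalk) \<Rightarrow> ('a, 'b) pre_digraph \<Rightarrow> ('a, 'b) pre_digraph \<Rightarrow>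
     'a set \<times> 'a \<Rightarrow> bool" where
  "pin V L D D' = (\<lambda>(S, \<alpha>).
     \<alpha> \<in> verts D - verts D' \<and> (\<forall>w \<in> S. ug_neighbor D w \<alpha>) \<and>
     (\<exists>x y. S = {x, y} \<and> (\<exists>i < num_walls V.
        let P = sub_wall V L D' i; Q = sub_wall V L D' (step V 1 i) in
        x \<in> subpath P (sub_b V L D' i) (last P) \<and>
        y \<in> subpath Q (hd Q) (sub_c V L D' (step V 1 i)) \<and>
        \<not> (\<exists>e \<in> cross_arcs V i.
             tail (vault_graph V) e \<in> subpath P (hd P) x - {x} \<and>
             head (vault_graph V) e \<in> subpath Q y (last Q) - {y}))))"

definition clasp ::
    "nat \<Rightarrow> ('a, 'b) pre_digraph \<Rightarrow> ('a, 'b) pre_digraph \<Rightarrow> 'a set \<times> 'a \<Rightarrow> bool" where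
  "clasp k D D' = (\<lambda>(S, \<alpha>).
     \<alpha> \<in> verts D - verts D' \<and> (\<forall>w \<in> S. ug_neighbor D w \<alpha>) \<and>
     (\<exists>vs es B. ug_cycle D vs es \<and> S \<union> {\<alpha>} \<subseteq> set vs \<and> card (set vs - verts D') \<le> k \<and>
        dicycle D B \<and> tail D ` set B \<inter> set vs = {}))"

end

theory Submission
  imports Defs
begin

text \<open>
  The walls, joined by the skip links, form one long dicycle that passes through the walls in the
  order \<open>P\<^sub>i, P\<^sub>i\<^sub>+\<^sub>2, P\<^sub>i\<^sub>+\<^sub>4, \<dots>\<close>. As \<open>\<ell>\<close> is odd, \<open>P\<^sub>i\<^sub>+\<^sub>1\<close> comes halfway after \<open>P\<^sub>i\<close>. Hence
  a link from \<open>p\<close> on \<open>P\<^sub>i\<close> to \<open>q\<close> on \<open>P\<^sub>i\<^sub>+\<^sub>1\<close> is a nearly antipodal chord: it closes the part of the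
  long dicycle from \<open>q\<close> to \<open>p\<close> to a dicycle, and leaves the open part from \<open>p\<close> to \<open>q\<close> as a
  path disjoint from it. If both \<open>u\<close> and \<open>v\<close>, or ends of the links containing them, lie on that
  path, there is a 1-clasp. No link does this only if \<open>u\<close> and \<open>v\<close> lie on consecutive walls and
  form a pin. Conversely, every dicycle must cross the two walls of a pin, which is impossible
  without meeting its two vertices.
\<close>

section \<open>Positions in lists\<close>

text \<open>Three implications suffice: a pin is a transversal, a pair that is not a pin is a
  1-clasp, and a clasp is not a transversal. Together they give both equivalences. The third holds
  because \<open>D'\<close> is the only large strong component, so the dicycle of a clasp lies in
  \<open>D'\<close>.

  That a pin is a transversal is not shown by following a dicycle, but by a potential: a rank on the
  vertices that grows along every arc whose head is not in the pin. Each of the three link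
  conditions of a pin accounts for one kind of link that would otherwise lower the rank.

  Two properties of \<open>l\<close> drive the search for a separating link. As \<open>l\<close> is
  odd, exactly one of the two ways around the ring between two walls has even length, and only an
  even length is a number of steps along the long dicycle. As \<open>l\<close> is at least 5, the
  successor of a neighbor of a wall is never itself a neighbor of that wall; hence a vertex inside a
  link always has an end of that link to be moved to that is on no neighbor of a given wall.\<close>

lemma before_nth_iff:
  assumes "distinct xs" "j < length xs" "k < length xs"
  shows "before xs (xs ! j) (xs ! k) \<longleftrightarrow> j < k"
proof
  assume "before xs (xs ! j) (xs ! k)"
  then obtain j' k' where "j' < k'" "k' < length xs" "xs ! j' = xs ! j" "xs ! k' = xs ! k"
    unfolding before_def by blast
  moreover from this have "j' = j" "k' = k"
    using assms by (auto simp: nth_eq_iff_index_eq)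
  ultimately show "j < k" by simp
qed (use assms in \<open>auto simp: before_def\<close>)

lemma before_in_set: "before xs x y \<Longrightarrow> x \<in> set xs \<and> y \<in> set xs"
  unfolding before_def by auto

lemma before_split_fst:
  assumes "before xs x y"
  obtains as bs where "xs = as @ x # bs" "y \<in> set bs"
proof -
  obtain j k where jk: "j < k" "k < length xs" "xs ! j = x" "xs ! k = y"
    using assms unfolding before_def by auto
  have "xs = take j xs @ x # drop (Suc j) xs"
    using jk by (metis id_take_nth_drop order.strict_trans)
  moreover have "y \<in> set (drop (Suc j) xs)"
    using jk nth_mem[of "k - Suc j" "drop (Suc j) xs"] by auto
  ultimately show ?thesis using that by blast
qed

lemma before_split_snd:
  assumes "before xs x y"
  obtains as bs where "xs = as @ y # bs" "x \<in> set as"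
proof -
  obtain j k where jk: "j < k" "k < length xs" "xs ! j = x" "xs ! k = y"
    using assms unfolding before_def by auto
  have "xs = take k xs @ y # drop (Suc k) xs"
    using jk by (metis id_take_nth_drop)
  moreover have "x \<in> set (take k xs)"
    using jk nth_mem[of j "take k xs"] by auto
  ultimately show ?thesis using that by blast
qed

lemma before_total:
  assumes "x \<in> set xs" "y \<in> set xs" "x \<noteq> y"
  shows "before xs x y \<or> before xs y x"
  using assms unfolding before_def in_set_conv_nth by (metis linorder_neqE_nat)

lemma before_asym: "distinct xs \<Longrightarrow> before xs x y \<Longrightarrow> \<not> before xs y x"
  unfolding before_def by (metis less_asym' nth_eq_iff_index_eq order.strict_trans)

lemma before_trans: "distinct xs \<Longrightarrow> before xs x y \<Longrightarrow> before xs y z \<Longrightarrow> before xs x z"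
  unfolding before_def by (metis nth_eq_iff_index_eq order.strict_trans)

lemma before_irrefl: "distinct xs \<Longrightarrow> \<not> before xs x x"
  using before_asym by metis

lemma before_hd: "z \<in> set xs \<Longrightarrow> z = hd xs \<or> before xs (hd xs) z"
  unfolding before_def in_set_conv_nth by (metis gr0I hd_conv_nth length_greater_0_conv not_less0)

lemma before_last: "z \<in> set xs \<Longrightarrow> z = last xs \<or> before xs z (last xs)"
proof -
  assume "z \<in> set xs"
  then obtain k where k: "k < length xs" "xs ! k = z" by (auto simp: in_set_conv_nth)
  then have last: "last xs = xs ! (length xs - 1)" by (intro last_conv_nth) auto
  show ?thesis
  proof (cases "k = length xs - 1")
    case False
    then have "before xs (xs ! k) (xs ! (length xs - 1))"
      unfolding before_def using k(1) by (intro exI[of _ k] exI[of _ "length xs - 1"]) auto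
    then show ?thesis using k(2) last by simp
  qed (use k(2) last in simp)
qed

lemma subpath_from_hd:
  "x \<in> set xs \<Longrightarrow> subpath xs (hd xs) x = {z. z = x \<or> before xs z x}"
  unfolding subpath_def using before_hd before_in_set by fast

lemma subpath_to_last:
  "x \<in> set xs \<Longrightarrow> subpath xs x (last xs) = {z. z = x \<or> before xs x z}"
  unfolding subpath_def using before_last before_in_set by fast

text \<open>Meant for \<open>sub_b\<close>: comparing with the last vertex satisfying
  \<open>Q\<close> is the same as quantifying over all of them, which removes the extremal vertex
  from the pin condition. The witness \<open>z\<close> keeps the filtered list nonempty, where
  \<open>last\<close> is meaningful.\<close>

lemma before_last_filter_iff:
  assumes "distinct xs" "z \<in> set xs" "Q z"
  shows "last (filter Q xs) \<in> set xs"
    and "before xs x (last (filter Q xs)) \<longleftrightarrow> (\<exists>z. Q z \<and> before xs x z)"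
proof -
  have "filter Q xs \<noteq> []" using assms by (auto simp: filter_empty_conv)
  then have "last (filter Q xs) \<in> set (filter Q xs)" by (rule last_in_set)
  then show m: "last (filter Q xs) \<in> set xs" by auto
  have Qm: "Q (last (filter Q xs))" using \<open>last (filter Q xs) \<in> set (filter Q xs)\<close> by auto
  have last: "\<not> before xs (last (filter Q xs)) z" if "Q z" for z
  proof
    assume "before xs (last (filter Q xs)) z"
    then obtain as bs where xs: "xs = as @ last (filter Q xs) # bs" "z \<in> set bs"
      by (rule before_split_fst)
    define m where "m = last (filter Q xs)"
    have "distinct (as @ m # bs)" using assms(1) xs(1) unfolding m_def by simp
    moreover have "m = last (filter Q bs)"
    proof -
      have "filter Q bs \<noteq> []" using xs(2) \<open>Q z\<close> by (auto simp: filter_empty_conv)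
      then have "last (filter Q (as @ m # bs)) = last (filter Q bs)" by simp
      then show ?thesis using xs(1) unfolding m_def by simp
    qed
    moreover have "filter Q bs \<noteq> []" using xs(2) \<open>Q z\<close> by (auto simp: filter_empty_conv)
    ultimately show False using last_in_set[of "filter Q bs"] by auto
  qed
  show "before xs x (last (filter Q xs)) \<longleftrightarrow> (\<exists>z. Q z \<and> before xs x z)"
    using Qm last m before_total before_trans[OF assms(1)] before_in_set by metis
qed

text \<open>The mirror image, meant for \<open>sub_c\<close>.\<close>

lemma before_hd_filter_iff:
  assumes "distinct xs" "z \<in> set xs" "Q z"
  shows "hd (filter Q xs) \<in> set xs"
    and "before xs (hd (filter Q xs)) x \<longleftrightarrow> (\<exists>z. Q z \<and> before xs z x)"
proof -
  have "filter Q xs \<noteq> []" using assms by (auto simp: filter_empty_conv)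
  then have "hd (filter Q xs) \<in> set (filter Q xs)" by (rule hd_in_set)
  then show m: "hd (filter Q xs) \<in> set xs" by auto
  have Qm: "Q (hd (filter Q xs))" using \<open>hd (filter Q xs) \<in> set (filter Q xs)\<close> by auto
  have first: "\<not> before xs z (hd (filter Q xs))" if "Q z" for z
  proof
    assume "before xs z (hd (filter Q xs))"
    then obtain as bs where xs: "xs = as @ hd (filter Q xs) # bs" "z \<in> set as"
      by (rule before_split_snd)
    define m where "m = hd (filter Q xs)"
    have ne: "filter Q as \<noteq> []" using xs(2) \<open>Q z\<close> by (auto simp: filter_empty_conv)
    have "distinct (as @ m # bs)" using assms(1) xs(1) unfolding m_def by simp
    moreover have "m = hd (filter Q as)"
    proof -
      have "hd (filter Q (as @ m # bs)) = hd (filter Q as)" using ne by simp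
      then show ?thesis using xs(1) unfolding m_def by simp
    qed
    ultimately show False using hd_in_set[OF ne] by auto
  qed
  show "before xs (hd (filter Q xs)) x \<longleftrightarrow> (\<exists>z. Q z \<and> before xs z x)"
    using Qm first m before_total before_trans[OF assms(1)] before_in_set by metis
qed

lemma successively_concat_map_upt:
  assumes "\<And>j. a \<le> j \<Longrightarrow> j < b \<Longrightarrow> f j \<noteq> [] \<and> successively r (f j)"
    and "\<And>j. a \<le> j \<Longrightarrow> Suc j < b \<Longrightarrow> r (last (f j)) (hd (f (Suc j)))"
  shows "successively r (concat (map f [a..<b]))"
  using assms
proof (induction b)
  case (Suc b)
  show ?case
  proof (cases "a < b")
    case True
    then have "concat (map f [a..<b]) \<noteq> [] \<and> last (concat (map f [a..<b])) = last (f (b - 1))"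
      using Suc.prems(1)[of "b - 1"] by (cases b) auto
    moreover have "r (last (f (b - 1))) (hd (f b))"
      using Suc.prems(2)[of "b - 1"] True by (cases b) auto
    ultimately show ?thesis
      using True Suc by (auto simp: successively_append_iff)
  next
    case False
    then have "[a..<Suc b] = (if a = b then [b] else [])" by auto
    then show ?thesis using Suc.prems(1)[of b] by auto
  qed
qed simp

lemma distinct_concat_map:
  assumes "distinct xs" "\<And>x. x \<in> set xs \<Longrightarrow> distinct (f x)"
    and "\<And>x y. x \<in> set xs \<Longrightarrow> y \<in> set xs \<Longrightarrow> x \<noteq> y \<Longrightarrow> set (f x) \<inter> set (f y) = {}"
  shows "distinct (concat (map f xs))"
  using assms
proof (induction xs)
  case (Cons x xs)
  then have "set (f x) \<inter> set (f y) = {}" if "y \<in> set xs" for y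
    using that Cons.prems(3)[of x y] by auto
  then show ?case using Cons by auto
qed simp

text \<open>The tails and the heads of a walk are two lists read at a common index; this trades an
  arc of the walk for that index.\<close>

lemma bex_set_iff_nth:
  "(\<exists>z \<in> set zs. x = f z \<and> y = g z) \<longleftrightarrow>
    (\<exists>k < length zs. x = map f zs ! k \<and> y = map g zs ! k)"
  by (metis in_set_conv_nth nth_map)

section \<open>Walks and cycles\<close>

lemma (in wf_digraph) awalk_map_head:
  assumes "awalk u p v" "p \<noteq> []"
  shows "map (head G) p = tl (map (tail G) p) @ [v]"
  using assms
proof (induction p arbitrary: u)
  case (Cons e es)
  then show ?case
  proof (cases es)
    case es: (Cons f fs)
    then have "awalk (head G e) es v" "head G e = tail G f"
      using \<open>awalk u (e # es) v\<close> by (auto simp: awalk_Cons_iff)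
    then show ?thesis using Cons.IH[of "head G e"] es by simp
  qed (auto simp: awalk_Cons_iff awalk_Nil_iff)
qed simp

text \<open>Loop erasure: if the path found so far already visits the vertex to be prepended, its
  suffix from that vertex is taken instead.\<close>

lemma rtrancl_imp_distinct_path:
  assumes "(u, v) \<in> r\<^sup>*"
  obtains xs where "xs \<noteq> []" "hd xs = u" "last xs = v" "distinct xs"
    "successively (\<lambda>a b. (a, b) \<in> r) xs"
proof -
  have "\<exists>xs. xs \<noteq> [] \<and> hd xs = u \<and> last xs = v \<and> distinct xs \<and>
      successively (\<lambda>a b. (a, b) \<in> r) xs"
    using assms
  proof (induction rule: converse_rtrancl_induct)
    case base
    then show ?case by (intro exI[of _ "[v]"]) auto
  next
    case (step a b)
    then obtain xs where xs: "xs \<noteq> []" "hd xs = b" "last xs = v" "distinct xs"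
      "successively (\<lambda>a b. (a, b) \<in> r) xs" by blast
    show ?case
    proof (cases "a \<in> set xs")
      case True
      then obtain as bs where "xs = as @ a # bs" by (meson split_list)
      then show ?thesis using xs
        by (intro exI[of _ "a # bs"]) (auto simp: successively_append_iff)
    next
      case False
      then show ?thesis using xs step(1)
        by (intro exI[of _ "a # xs"]) (auto simp: successively_Cons)
    qed
  qed
  then show ?thesis using that by blast
qed

text \<open>Adjacency in the underlying graph of \<open>G - W\<close>, as a relation on vertices so
  that connectedness is its closure. The reflexive closure also relates a vertex of
  \<open>W\<close>, or one outside \<open>G\<close>, to itself; the use for cycles therefore
  requires \<open>u\<close> and \<open>v\<close> to differ.\<close>

definition avoiding_edges :: "('a, 'b) pre_digraph \<Rightarrow> 'a set \<Rightarrow> ('a \<times> 'a) set" where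
  "avoiding_edges G W = {(a, b). a \<notin> W \<and> b \<notin> W \<and> (a \<rightarrow>\<^bsub>G\<^esub> b \<or> b \<rightarrow>\<^bsub>G\<^esub> a)}"

lemma avoiding_edges_rtrancl_sym:
  "(a, b) \<in> (avoiding_edges G W)\<^sup>* \<Longrightarrow> (b, a) \<in> (avoiding_edges G W)\<^sup>*"
  by (rule symD[OF sym_rtrancl]) (auto simp: avoiding_edges_def sym_def)

lemma successively_imp_avoiding_rtrancl:
  assumes "successively (\<lambda>a b. a \<rightarrow>\<^bsub>G\<^esub> b) zs" "set zs \<inter> W = {}" "a \<in> set zs" "b \<in> set zs"
  shows "(a, b) \<in> (avoiding_edges G W)\<^sup>*"
proof -
  have from_hd: "(hd zs, c) \<in> (avoiding_edges G W)\<^sup>*" if "c \<in> set zs" for c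
    using assms(1,2) that
  proof (induction zs)
    case (Cons z zs)
    show ?case
    proof (cases "c = z")
      case False
      with Cons have c: "c \<in> set zs" and "(hd zs, c) \<in> (avoiding_edges G W)\<^sup>*"
        by (auto simp: successively_Cons)
      moreover have "hd zs \<in> set zs" using c by (cases zs) auto
      then have "(z, hd zs) \<in> avoiding_edges G W"
        using Cons.prems by (auto simp: successively_Cons avoiding_edges_def)
      ultimately show ?thesis by auto
    qed simp
  qed simp
  show ?thesis
    using avoiding_edges_rtrancl_sym[OF from_hd] from_hd assms(3,4)
    by (meson rtrancl_trans)
qed

text \<open>A path from \<open>u\<close> to \<open>v\<close> outside \<open>W\<close> is closed by
  the two arcs at \<alpha>, which is not on the path as it lies outside \<open>G\<close>.\<close>

lemma ug_cycle_if_connected: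
  assumes "wf_digraph G"
    and conn: "(u, v) \<in> (avoiding_edges G W)\<^sup>*" and "u \<noteq> v"
    and H: "arcs G \<subseteq> arcs D" "verts G \<subseteq> verts D" "tail D = tail G" "head D = head G"
    and \<alpha>: "\<alpha> \<in> verts D - verts G" "ug_neighbor D u \<alpha>" "ug_neighbor D v \<alpha>"
  shows "\<exists>vs es. ug_cycle D vs es \<and> {u, v, \<alpha>} \<subseteq> set vs \<and> set vs \<subseteq> insert \<alpha> (verts G - W)"
proof -
  interpret G: wf_digraph G by fact
  obtain xs where xs: "xs \<noteq> []" "hd xs = u" "last xs = v" "distinct xs"
      "successively (\<lambda>a b. (a, b) \<in> avoiding_edges G W) xs"
    using rtrancl_imp_distinct_path[OF conn] .
  obtain x ys where xs_eq: "xs = x # ys" using xs(1) by (cases xs) auto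
  with xs \<open>u \<noteq> v\<close> have "ys \<noteq> []" by auto
  have edge: "(xs ! j, xs ! Suc j) \<in> avoiding_edges G W" if "Suc j < length xs" for j
    using xs(5) that by (auto simp: successively_conv_nth)
  have len: "2 \<le> length xs" using xs_eq \<open>ys \<noteq> []\<close> by (cases ys) auto
  have sub: "set xs \<subseteq> verts G - W"
  proof
    fix z assume "z \<in> set xs"
    then obtain j where j: "j < length xs" "xs ! j = z" by (auto simp: in_set_conv_nth)
    \<comment> \<open>The closure does not ensure membership in \<open>G - W\<close>; an incident
      edge does, and it exists because the path has at least two vertices.\<close>
    have "\<exists>z'. (z, z') \<in> avoiding_edges G W \<or> (z', z) \<in> avoiding_edges G W"
    proof (cases "Suc j < length xs")
      case True then show ?thesis using edge[of j] j by auto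
    next
      case False
      then have "j = Suc (j - 1)" "Suc (j - 1) < length xs" using j len by auto
      then show ?thesis using edge[of "j - 1"] j by auto
    qed
    then show "z \<in> verts G - W"
      by (auto simp: avoiding_edges_def arcs_ends_conv)
  qed
  have first: "xs ! 0 = u"
    using xs(1,2) by (metis hd_conv_nth)
  have last: "xs ! j = v" if "Suc j = length xs" for j
    using xs(1,3) that by (metis diff_Suc_1 last_conv_nth)
  define vs where "vs = xs @ [\<alpha>]"
  have vs: "distinct vs" "set vs \<subseteq> verts D" "3 \<le> length vs" "set vs \<subseteq> insert \<alpha> (verts G - W)"
    using xs(4) sub \<alpha>(1) len H(2) unfolding vs_def by auto
  have "\<exists>e \<in> arcs D. {tail D e, head D e} = {vs ! j, vs ! (Suc j mod length vs)}"
    if j: "j < length vs" for j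
  proof -
    consider "Suc j < length xs" | "Suc j = length xs" | "j = length xs"
      using j unfolding vs_def by fastforce
    then show ?thesis
    proof cases
      case 1
      then have "(vs ! j, vs ! (Suc j mod length vs)) \<in> avoiding_edges G W"
        using edge[of j] by (auto simp: vs_def nth_append)
      then show ?thesis using H
        by (auto simp: avoiding_edges_def arcs_ends_conv)
    next
      case 2
      then have "vs ! j = v" "vs ! (Suc j mod length vs) = \<alpha>"
        using last by (auto simp: vs_def nth_append)
      then show ?thesis using \<alpha>(3) unfolding ug_neighbor_def by auto
    next
      case 3
      then have "vs ! j = \<alpha>" "vs ! (Suc j mod length vs) = u"
        using first \<open>xs \<noteq> []\<close> by (simp_all add: vs_def nth_append)
      then show ?thesis using \<alpha>(2) unfolding ug_neighbor_def by (auto simp: insert_commute)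
    qed
  qed
  then obtain f where f: "\<And>j. j < length vs \<Longrightarrow> f j \<in> arcs D \<and>
      {tail D (f j), head D (f j)} = {vs ! j, vs ! (Suc j mod length vs)}"
    by metis
  have "inj_on f {0..<length vs}"
  proof (rule inj_onI)
    fix i j assume ij: "i \<in> {0..<length vs}" "j \<in> {0..<length vs}" "f i = f j"
    let ?n = "length vs"
    have eq: "{vs ! i, vs ! (Suc i mod ?n)} = {vs ! j, vs ! (Suc j mod ?n)}"
      using f[of i] f[of j] ij by auto
    have "Suc i mod ?n < ?n" "Suc j mod ?n < ?n"
      using vs(3) by - (rule mod_less_divisor, linarith)+
    \<comment> \<open>Two positions with the same pair of consecutive vertices would be successors
      of each other, which needs a cycle of length 2. Here the length is at least 3, so the arcs
      chosen for different positions differ.\<close>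
    then have "i = j \<or> (i = Suc j mod ?n \<and> j = Suc i mod ?n)"
      using eq ij vs(1) by (auto simp: doubleton_eq_iff nth_eq_iff_index_eq)
    then show "i = j"
      using ij vs(3) by (auto simp: mod_Suc split: if_splits)
  qed
  then have "ug_cycle D vs (map f [0..<length vs])"
    using vs f unfolding ug_cycle_def by (auto simp: distinct_map)
  moreover have "{u, v, \<alpha>} \<subseteq> set vs" using xs(1-3) unfolding vs_def by auto
  ultimately show ?thesis using vs(4) by blast
qed

text \<open>If the arcs within the finite set \<open>W\<close> were acyclic, some vertex of
  \<open>W\<close> would have no out-neighbor in \<open>W\<close>. Looplessness is needed since a
  library cycle may be a loop, which is not a dicycle.\<close>

lemma dicycle_if_out_neighbors:
  assumes "wf_digraph G" "finite W" "W \<noteq> {}" "W \<subseteq> verts G"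
    and out: "\<And>w. w \<in> W \<Longrightarrow> \<exists>w' \<in> W. w \<rightarrow>\<^bsub>G\<^esub> w'" and loopfree: "\<And>w. \<not> w \<rightarrow>\<^bsub>G\<^esub> w"
  obtains p where "dicycle G p" "tail G ` set p \<subseteq> W"
proof -
  interpret G: wf_digraph G by fact
  let ?H = "G \<restriction> W"
  have sub: "subgraph ?H G"
    using \<open>W \<subseteq> verts G\<close> by (rule G.subgraph_induce_subgraphI)
  then interpret H: wf_digraph ?H by (auto simp: subgraph_def)
  have ends: "arcs_ends ?H = {(a, b). a \<in> W \<and> b \<in> W \<and> a \<rightarrow>\<^bsub>G\<^esub> b}"
    by (auto simp: arcs_ends_conv)
  have "finite (arcs_ends ?H)"
    by (rule finite_subset[of _ "W \<times> W"]) (use assms(2) ends in auto)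
  have "\<not> acyclic (arcs_ends ?H)"
  proof
    assume "acyclic (arcs_ends ?H)"
    with \<open>finite (arcs_ends ?H)\<close> have "wf ((arcs_ends ?H)\<inverse>)"
      by (rule finite_acyclic_wf_converse)
    with \<open>W \<noteq> {}\<close> obtain z where "z \<in> W" "\<And>y. (y, z) \<in> (arcs_ends ?H)\<inverse> \<Longrightarrow> y \<notin> W"
      by (metis all_not_in_conv wfE_min)
    moreover from out[OF this(1)] obtain w where "w \<in> W" "z \<rightarrow>\<^bsub>G\<^esub> w" by blast
    ultimately show False using ends by blast
  qed
  then obtain z where "z \<rightarrow>\<^sup>+\<^bsub>?H\<^esub> z" unfolding acyclic_def by auto
  then obtain q where "H.awalk z q z" "q \<noteq> []" by (auto simp: H.reachable1_awalk)
  then have "H.closed_w q" unfolding H.closed_w_def by auto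
  then obtain p where p: "H.cycle p" using H.closed_w_imp_cycle by blast
  then have "G.cycle p" using G.subgraph_cycle[OF sub] by blast
  have set_p: "set p \<subseteq> arcs ?H" and "p \<noteq> []" using p unfolding H.cycle_def by (auto simp: H.awalk_def)
  have "length p \<noteq> 1"
  proof
    assume "length p = 1"
    then obtain e where "p = [e]" by (auto simp: length_Suc_conv)
    with \<open>G.cycle p\<close> have "e \<in> arcs G" "tail G e = head G e"
      by (auto simp: G.cycle_def G.awalk_def)
    then have "tail G e \<rightarrow>\<^bsub>G\<^esub> tail G e"
      by (metis G.in_arcs_imp_in_arcs_ends)
    with loopfree show False by blast
  qed
  moreover have "length p \<noteq> 0" using \<open>p \<noteq> []\<close> by simp
  ultimately have "dicycle G p" using \<open>G.cycle p\<close> unfolding dicycle_def by linarith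
  moreover have "tail G ` set p \<subseteq> W" using set_p by auto
  ultimately show ?thesis by (rule that)
qed

section \<open>Rings of walls\<close>

text \<open>
  The walls are indexed by all natural numbers and repeat with period \<open>l\<close>; \<open>E n\<close> indexes the
  links from \<open>P n\<close> to \<open>P (Suc n)\<close>, where the link \<open>e\<close> starts in \<open>s e\<close>, ends in \<open>t e\<close> and has the
  internal vertices \<open>I e\<close>.
\<close>

locale wall_ring =
  fixes G :: "('a, 'b) pre_digraph" and l :: nat and P :: "nat \<Rightarrow> 'a list" and E :: "nat \<Rightarrow> 'c set"
    and s t :: "'c \<Rightarrow> 'a" and I :: "'c \<Rightarrow> 'a list"
  assumes fin: "fin_digraph G"
    and l: "5 \<le> l" "odd l"
    and P_period: "P (n + l) = P n"
    and E_period: "E (n + l) = E n"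
    and P_nonempty: "P n \<noteq> []"
    and P_distinct: "distinct (P n)"
    and P_disjoint: "m mod l \<noteq> n mod l \<Longrightarrow> set (P m) \<inter> set (P n) = {}"
    and E_nonempty: "E n \<noteq> {}"
    and s_wall: "e \<in> E n \<Longrightarrow> s e \<in> set (P n)"
    and t_wall: "e \<in> E n \<Longrightarrow> t e \<in> set (P (Suc n))"
    and I_distinct: "e \<in> E n \<Longrightarrow> distinct (I e)"
    and I_wall: "e \<in> E n \<Longrightarrow> set (I e) \<inter> set (P m) = {}"
    and I_disjoint: "e \<in> E m \<Longrightarrow> f \<in> E n \<Longrightarrow> e \<noteq> f \<Longrightarrow> set (I e) \<inter> set (I f) = {}"
    and verts: "verts G = (\<Union>n. set (P n) \<union> (\<Union>e \<in> E n. set (I e)))"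
    and dominates_iff: "x \<rightarrow>\<^bsub>G\<^esub> y \<longleftrightarrow>
      (\<exists>n k. Suc k < length (P n) \<and> x = P n ! k \<and> y = P n ! Suc k) \<or>
      (\<exists>n. x = last (P n) \<and> y = hd (P (n + 2))) \<or>
      (\<exists>n. \<exists>e \<in> E n. \<exists>k \<le> length (I e). x = (s e # I e) ! k \<and> y = (I e @ [t e]) ! k)"
begin

lemma P_add_mult: "P (n + l * k) = P n"
proof (induction k)
  case (Suc k)
  have "n + l * Suc k = n + l * k + l" by simp
  then show ?case using Suc P_period[of "n + l * k"] by metis
qed simp

lemma E_add_mult: "E (n + l * k) = E n"
proof (induction k)
  case (Suc k)
  have "n + l * Suc k = n + l * k + l" by simp
  then show ?case using Suc E_period[of "n + l * k"] by metis
qed simp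

lemma P_mod: "P (n mod l) = P n"
  using P_add_mult[of "n mod l" "n div l"] by simp

lemma E_mod: "E (n mod l) = E n"
  using E_add_mult[of "n mod l" "n div l"] by simp

lemma P_cong: "m mod l = n mod l \<Longrightarrow> P m = P n"
  by (metis P_mod)

lemma E_cong: "m mod l = n mod l \<Longrightarrow> E m = E n"
  by (metis E_mod)

lemma in_P_unique: "z \<in> set (P m) \<Longrightarrow> z \<in> set (P n) \<Longrightarrow> m mod l = n mod l"
  using P_disjoint[of m n] by blast

lemma mod_l_neqI:
  assumes "a < b" "b < a + l"
  shows "a mod l \<noteq> b mod l"
proof
  assume "a mod l = b mod l"
  then have "l dvd b - a" using assms(1) by (metis less_imp_le mod_eq_dvd_iff_nat)
  then show False using assms by (auto dest: dvd_imp_le)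
qed

text \<open>2 is invertible modulo an odd \<open>l\<close>. Thus \<open>l\<close> steps of two visit
  every wall exactly once, so that the skip links join the walls into one dicycle rather than
  several.\<close>

lemma double_mod_l_inj:
  assumes "(n + 2 * j) mod l = (n + 2 * k) mod l" "j < l" "k < l"
  shows "j = k"
proof -
  have "j = k" if "(n + 2 * j) mod l = (n + 2 * k) mod l" "j \<le> k" "k < l" for j k
  proof -
    have "l dvd (n + 2 * k) - (n + 2 * j)"
      using that by (metis mod_eq_dvd_iff_nat add_le_cancel_left mult_le_mono2)
    then have "l dvd 2 * (k - j)" by (simp add: diff_mult_distrib2)
    then have "l dvd k - j" using l(2) by (metis coprime_dvd_mult_right_iff coprime_right_2_iff_odd)
    then show ?thesis using that by (auto dest: dvd_imp_le)
  qed
  then show ?thesis using assms by (metis linear)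
qed

lemma wall_dominates: "successively (\<lambda>a b. a \<rightarrow>\<^bsub>G\<^esub> b) (P n)"
  unfolding successively_conv_nth dominates_iff by blast

lemma skip_dominates: "last (P n) \<rightarrow>\<^bsub>G\<^esub> hd (P (n + 2))"
  unfolding dominates_iff by blast

lemma link_dominates:
  assumes "e \<in> E n"
  shows "successively (\<lambda>a b. a \<rightarrow>\<^bsub>G\<^esub> b) (s e # I e @ [t e])"
  unfolding successively_conv_nth
proof (intro allI impI)
  fix k assume "Suc k < length (s e # I e @ [t e])"
  then have "k \<le> length (I e)" by simp
  moreover have "(s e # I e @ [t e]) ! k = (s e # I e) ! k"
    using \<open>k \<le> length (I e)\<close> by (cases k) (auto simp: nth_append)
  ultimately show "(s e # I e @ [t e]) ! k \<rightarrow>\<^bsub>G\<^esub> (s e # I e @ [t e]) ! Suc k"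
    unfolding dominates_iff using assms by (metis nth_Cons_Suc)
qed

lemma loopfree: "\<not> x \<rightarrow>\<^bsub>G\<^esub> x"
proof
  assume "x \<rightarrow>\<^bsub>G\<^esub> x"
  then consider n k where "Suc k < length (P n)" "P n ! k = P n ! Suc k"
    | n where "last (P n) = hd (P (n + 2))"
    | n e k where "e \<in> E n" "k \<le> length (I e)" "(s e # I e) ! k = (I e @ [t e]) ! k"
    unfolding dominates_iff by metis
  then show False
  proof cases
    case 1
    then show False using P_distinct[of n] by (simp add: nth_eq_iff_index_eq)
  next
    case 2
    have "n mod l \<noteq> (n + 2) mod l" using l(1) by (intro mod_l_neqI) auto
    then show False using P_disjoint 2 P_nonempty
      by (metis disjoint_iff hd_in_set last_in_set)
  next
    case 3
    have "n mod l \<noteq> Suc n mod l" using l(1) by (intro mod_l_neqI) auto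
    then have "s e \<noteq> t e" using in_P_unique s_wall[OF 3(1)] t_wall[OF 3(1)] by metis
    then have "distinct (s e # I e @ [t e])"
      using I_distinct[OF 3(1)] I_wall[OF 3(1)] s_wall[OF 3(1)] t_wall[OF 3(1)] by auto
    moreover have "(s e # I e @ [t e]) ! k = (s e # I e @ [t e]) ! Suc k"
      using 3(2,3) by (cases k) (auto simp: nth_append)
    ultimately show False using 3(2) nth_eq_iff_index_eq[of "s e # I e @ [t e]" k "Suc k"] by simp
  qed
qed

subsection \<open>A dicycle through a link and a path avoiding it\<close>

text \<open>The inverse of 2 modulo \<open>l\<close>: \<open>half\<close> steps of two go once
  around the ring and one wall further, from \<open>P n\<close> to \<open>P (Suc n)\<close>.\<close>

definition half :: nat where
  "half = (l + 1) div 2"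

lemma two_half: "2 * half = l + 1"
  using l(2) unfolding half_def by simp

text \<open>A stretch of the long dicycle, with its walls numbered from \<open>P n\<close> in steps
  of two. For \<open>j = 0\<close> and \<open>k = l\<close> it is the whole dicycle, cut open in
  front of \<open>P n\<close>.\<close>

definition walls_between :: "nat \<Rightarrow> nat \<Rightarrow> nat \<Rightarrow> 'a list" where
  "walls_between n j k = concat (map (\<lambda>m. P (n + 2 * m)) [j..<k])"

lemma walls_between_dominates: "successively (\<lambda>a b. a \<rightarrow>\<^bsub>G\<^esub> b) (walls_between n j k)"
  unfolding walls_between_def
proof (rule successively_concat_map_upt)
  show "last (P (n + 2 * m)) \<rightarrow>\<^bsub>G\<^esub> hd (P (n + 2 * Suc m))" for m
    using skip_dominates[of "n + 2 * m"] by simp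
qed (use P_nonempty wall_dominates in auto)

lemma walls_between_distinct: "distinct (walls_between n 0 l)"
  unfolding walls_between_def
proof (rule distinct_concat_map)
  show "set (P (n + 2 * j)) \<inter> set (P (n + 2 * k)) = {}"
    if "j \<in> set [0..<l]" "k \<in> set [0..<l]" "j \<noteq> k" for j k
    using that double_mod_l_inj[of n j k] by (intro P_disjoint) auto
qed (use P_distinct in auto)

lemma walls_between_append:
  "i \<le> j \<Longrightarrow> j \<le> k \<Longrightarrow> walls_between n i k = walls_between n i j @ walls_between n j k"
  unfolding walls_between_def
  by (metis concat_append map_append le_Suc_ex upt_add_eq_append)

lemma walls_between_Suc: "walls_between n j (Suc j) = P (n + 2 * j)"
  unfolding walls_between_def by simp

lemma P_half: "P (n + 2 * half) = P (Suc n)"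
  using P_period[of "Suc n"] unfolding two_half by (simp add: add.commute)

text \<open>In the long dicycle, \<open>P n\<close> is wall number 0 and \<open>P (Suc n)\<close> is
  wall number \<open>half\<close>. Cutting these two at the ends of \<open>e\<close> leaves
  \<open>X\<close> strictly between \<open>s e\<close> and \<open>t e\<close>; the rest closes up
  through the inside of \<open>e\<close> and forms \<open>W\<close>. Other links have their inner
  vertices outside \<open>W\<close>, so those remain available for reaching
  \<open>X\<close>.\<close>

lemma split_at_link:
  assumes e: "e \<in> E n" and n: "P n = as @ s e # bs" and Suc_n: "P (Suc n) = cs @ t e # ds"
  defines "X \<equiv> bs @ walls_between n 1 half @ cs"
  obtains W where "W \<subseteq> verts G" "s e \<in> W" "t e \<in> W"
    "\<And>w. w \<in> W \<Longrightarrow> \<exists>w' \<in> W. w \<rightarrow>\<^bsub>G\<^esub> w'" "set X \<inter> W = {}"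
    "\<And>f m. f \<in> E m \<Longrightarrow> f \<noteq> e \<Longrightarrow> set (I f) \<inter> W = {}"
    "\<And>x y. x \<in> set X \<Longrightarrow> y \<in> set X \<Longrightarrow> (x, y) \<in> (avoiding_edges G W)\<^sup>*"
proof -
  let ?r = "\<lambda>a b. a \<rightarrow>\<^bsub>G\<^esub> b"
  define Y where "Y = t e # ds @ walls_between n (Suc half) l @ as @ [s e]"
  have half: "1 \<le> half" "Suc half \<le> l" using two_half l(1) by auto
  have "walls_between n 0 l = walls_between n 0 1 @ walls_between n 1 half @
      walls_between n half (Suc half) @ walls_between n (Suc half) l"
    using half by (metis walls_between_append append_assoc le0 le_add2 plus_1_eq_Suc le_trans)
  then have Z: "walls_between n 0 l = as @ s e # X @ t e # ds @ walls_between n (Suc half) l"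
    using n Suc_n walls_between_Suc[of n 0] walls_between_Suc[of n half] unfolding P_half X_def by simp
  have succ_Z: "successively ?r (as @ s e # X @ t e # ds @ walls_between n (Suc half) l)"
    using walls_between_dominates[of n 0 l] unfolding Z .
  have dist_Z: "distinct (as @ s e # X @ t e # ds @ walls_between n (Suc half) l)"
    using walls_between_distinct[of n] unfolding Z .
  \<comment> \<open>\<open>Y\<close> runs past the end of the list of \<open>l\<close> walls. One
    more step of two from the last wall makes \<open>2 * l\<close> in total, so its skip link
    returns to the start of \<open>P n\<close>.\<close>
  have last_hd: "last (t e # ds @ walls_between n (Suc half) l) \<rightarrow>\<^bsub>G\<^esub> hd (as @ [s e])"
  proof -
    have "walls_between n 0 l = walls_between n 0 (l - 1) @ P (n + 2 * (l - 1))"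
      using walls_between_append[of 0 "l - 1" l n] walls_between_Suc[of n "l - 1"] l(1) by simp
    then have "last (walls_between n 0 l) = last (P (n + 2 * (l - 1)))"
      using P_nonempty by simp
    moreover have "P (n + 2 * (l - 1) + 2) = P n"
    proof -
      have "n + 2 * (l - 1) + 2 = n + l * 2" using l(1) by simp
      then show ?thesis using P_add_mult by metis
    qed
    moreover have "hd (P n) = hd (as @ [s e])" using n by (cases as) auto
    ultimately show ?thesis using skip_dominates[of "n + 2 * (l - 1)"] unfolding Z by simp
  qed
  have link: "successively ?r (s e # I e @ [t e])" using link_dominates[OF e] .
  define W where "W = set (Y @ I e)"
  have walls: "set Y \<union> set X \<subseteq> (\<Union>m. set (P m))"
  proof -
    have "set (walls_between n 0 l) \<subseteq> (\<Union>m. set (P m))" unfolding walls_between_def by auto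
    then show ?thesis unfolding Z Y_def by auto
  qed
  show ?thesis
  proof (rule that)
    show "W \<subseteq> verts G" using walls e unfolding W_def verts by auto
    show "s e \<in> W" "t e \<in> W" unfolding W_def Y_def by auto
    show "set X \<inter> W = {}"
    proof -
      have "set X \<inter> set Y = {}" using dist_Z unfolding Y_def by auto
      moreover have "set X \<inter> set (I e) = {}" using walls I_wall[OF e] by blast
      ultimately show ?thesis unfolding W_def by auto
    qed
    show "set (I f) \<inter> W = {}" if "f \<in> E m" "f \<noteq> e" for f m
    proof -
      have "set (I f) \<inter> set Y = {}" using walls I_wall[OF that(1)] by blast
      then show ?thesis using I_disjoint[OF that(1) e that(2)] unfolding W_def by auto
    qed
    show "(x, y) \<in> (avoiding_edges G W)\<^sup>*" if "x \<in> set X" "y \<in> set X" for x y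
    proof (rule successively_imp_avoiding_rtrancl)
      show "successively ?r X" using succ_Z by (auto simp: successively_append_iff successively_Cons)
    qed (use that \<open>set X \<inter> W = {}\<close> in auto)
    have Y_I: "successively ?r (Y @ I e @ [t e])"
    proof -
      have "successively ?r (t e # ds @ walls_between n (Suc half) l)"
        and "successively ?r (as @ [s e])"
        using succ_Z by (auto simp: successively_append_iff successively_Cons)
      then have "successively ?r ((t e # ds @ walls_between n (Suc half) l) @ (as @ [s e]))"
        using last_hd by (subst successively_append_iff) auto
      then have "successively ?r Y" "last Y = s e" unfolding Y_def by simp_all
      then show ?thesis using link by (subst successively_append_iff) (auto simp: successively_Cons)
    qed
    show "\<exists>w' \<in> W. w \<rightarrow>\<^bsub>G\<^esub> w'" if w: "w \<in> W" for w
    proof -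
      \<comment> \<open>The out-neighbor is the next entry of \<open>Y @ I e @ [t e]\<close>; the
        final \<open>t e\<close> is the first entry of \<open>Y\<close> again, so the sequence is
        closed.\<close>
      obtain xs ys where "Y @ I e = xs @ w # ys" using w split_list[of w "Y @ I e"] unfolding W_def by blast
      then have eq: "Y @ I e @ [t e] = xs @ w # ys @ [t e]" by simp
      have "w \<rightarrow>\<^bsub>G\<^esub> hd (ys @ [t e])"
        using Y_I unfolding eq by (simp add: successively_append_iff successively_Cons)
      moreover have "hd (ys @ [t e]) \<in> W"
        using \<open>t e \<in> W\<close> unfolding W_def \<open>Y @ I e = xs @ w # ys\<close> by (cases ys) auto
      ultimately show ?thesis by blast
    qed
  qed
qed

text \<open>
  The set \<open>W\<close> stands for a dicycle: it contains one, as each of its vertices has an out-neighbor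
  in it.
\<close>

definition apart :: "'a \<Rightarrow> 'a \<Rightarrow> bool" where
  "apart u v \<longleftrightarrow> (\<exists>W. W \<subseteq> verts G \<and> W \<noteq> {} \<and> (\<forall>w \<in> W. \<exists>w' \<in> W. w \<rightarrow>\<^bsub>G\<^esub> w') \<and>
     (u, v) \<in> (avoiding_edges G W)\<^sup>*)"

text \<open>Allows vertices on walls and vertices inside links to be treated alike: a representative
  \<open>p\<close> on a wall is placed on the free path, and \<open>u\<close> is joined to it along
  its own link.\<close>

definition attached :: "'a \<Rightarrow> 'a \<Rightarrow> bool" where
  "attached u p \<longleftrightarrow> u = p \<or> (\<exists>n. \<exists>e \<in> E n. u \<in> set (I e) \<and> p \<in> {s e, t e})"

lemma apart_sym: "apart u v \<Longrightarrow> apart v u"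
  unfolding apart_def by (metis avoiding_edges_rtrancl_sym)

lemma attached_refl: "attached u u"
  unfolding attached_def by simp

lemma apart_if_link:
  assumes e: "e \<in> E n" and n: "P n = as @ s e # bs" and Suc_n: "P (Suc n) = cs @ t e # ds"
    and u: "attached u p" and v: "attached v r"
    and pr: "{p, r} \<subseteq> set (bs @ walls_between n 1 half @ cs)"
  shows "apart u v"
proof -
  obtain W where W: "W \<subseteq> verts G" "s e \<in> W" "t e \<in> W"
    "\<And>w. w \<in> W \<Longrightarrow> \<exists>w' \<in> W. w \<rightarrow>\<^bsub>G\<^esub> w'" "set (bs @ walls_between n 1 half @ cs) \<inter> W = {}"
    "\<And>f m. f \<in> E m \<Longrightarrow> f \<noteq> e \<Longrightarrow> set (I f) \<inter> W = {}"
    "\<And>x y. x \<in> set (bs @ walls_between n 1 half @ cs) \<Longrightarrow>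
      y \<in> set (bs @ walls_between n 1 half @ cs) \<Longrightarrow> (x, y) \<in> (avoiding_edges G W)\<^sup>*"
    using split_at_link[OF e n Suc_n] by blast
  have conn: "(z, q) \<in> (avoiding_edges G W)\<^sup>*"
    if z: "attached z q" and q: "q \<in> {p, r}" for z q
  proof (cases "z = q")
    case False
    then obtain m f where f: "f \<in> E m" "z \<in> set (I f)" "q \<in> {s f, t f}"
      using z unfolding attached_def by blast
    \<comment> \<open>Both ends of \<open>e\<close> are in \<open>W\<close> and \<open>q\<close> is
      not, so the link through \<open>z\<close> is not \<open>e\<close> and its inner vertices avoid
      \<open>W\<close>.\<close>
    have "q \<notin> W" using q pr W(5) by blast
    with f W(2,3) have "f \<noteq> e" by auto
    then have I_W: "set (I f) \<inter> W = {}" using W(6) f(1) by blast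
    note link = link_dominates[OF f(1)]
    consider "q = s f" | "q = t f" using f(3) by blast
    then show ?thesis
    proof cases
      case 1
      have "successively (\<lambda>a b. a \<rightarrow>\<^bsub>G\<^esub> b) (s f # I f)"
        using link successively_append_iff[of _ "s f # I f" "[t f]"] by simp
      then show ?thesis
        by (rule successively_imp_avoiding_rtrancl) (use I_W f \<open>q \<notin> W\<close> 1 in auto)
    next
      case 2
      have "successively (\<lambda>a b. a \<rightarrow>\<^bsub>G\<^esub> b) (I f @ [t f])"
        using link by (simp add: successively_Cons)
      then show ?thesis
        by (rule successively_imp_avoiding_rtrancl) (use I_W f \<open>q \<notin> W\<close> 2 in auto)
    qed
  qed simp
  have "(u, p) \<in> (avoiding_edges G W)\<^sup>*" using conn[OF u] by simp
  moreover have "(p, r) \<in> (avoiding_edges G W)\<^sup>*" using W(7) pr by blast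
  moreover have "(r, v) \<in> (avoiding_edges G W)\<^sup>*"
    using avoiding_edges_rtrancl_sym[OF conn[OF v]] by simp
  ultimately have "(u, v) \<in> (avoiding_edges G W)\<^sup>*" by (meson rtrancl_trans)
  then show ?thesis using W(1,2,4) unfolding apart_def by blast
qed

section \<open>Pairs of vertices on the free path of some link\<close>

lemma link_splits:
  assumes "e \<in> E n"
  obtains as bs cs ds where "P n = as @ s e # bs" "P (Suc n) = cs @ t e # ds"
  using split_list[OF s_wall[OF assms]] split_list[OF t_wall[OF assms]] by blast

lemma in_walls_between:
  "z \<in> set (P (n + 2 * m)) \<Longrightarrow> j \<le> m \<Longrightarrow> m < k \<Longrightarrow> z \<in> set (walls_between n j k)"
  unfolding walls_between_def by auto

lemma apart_if_even_distance:
  assumes "attached u p" "attached v r" "p \<in> set (P i)" "r \<in> set (P (i + 2 * m))" "Suc m < half"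
  shows "apart u v"
proof -
  \<comment> \<open>This is \<open>i - 2\<close> modulo \<open>l\<close>. Seen from there, the two
    walls are number 1 and number \<open>m + 1\<close>, and any link starting in \<open>P n\<close>
    leaves the walls number 1 to \<open>half - 1\<close> entirely free.\<close>
  define n where "n = i + (l - 2)"
  have "n + 2 * 1 = i + l" "n + 2 * Suc m = (i + 2 * m) + l"
    using l(1) unfolding n_def by simp_all
  then have "P (n + 2 * 1) = P i" "P (n + 2 * Suc m) = P (i + 2 * m)"
    by (metis P_period)+
  then have "{p, r} \<subseteq> set (walls_between n 1 half)"
    using assms(3-5) in_walls_between[of _ n 1 1 half] in_walls_between[of _ n "Suc m" 1 half]
    by auto
  moreover obtain e where e: "e \<in> E n" using E_nonempty by blast
  moreover obtain as bs cs ds where "P n = as @ s e # bs" "P (Suc n) = cs @ t e # ds"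
    using link_splits[OF e] .
  ultimately show ?thesis
    using apart_if_link[OF e _ _ assms(1,2)] by auto
qed

text \<open>Of the distances \<open>d\<close> and \<open>l - d\<close> around the ring one is even.
  The largest even distance below \<open>l\<close> is \<open>l - 1\<close>, which occurs only for
  consecutive walls; all smaller ones are covered by \<open>apart_if_even_distance\<close>.\<close>

lemma apart_if_not_consecutive:
  assumes "attached u p" "attached v r" "p \<in> set (P i)" "r \<in> set (P j)"
    and "Suc i mod l \<noteq> j mod l" "Suc j mod l \<noteq> i mod l"
  shows "apart u v"
proof -
  have ordered: "apart u v"
    if uv: "attached u p" "attached v r" and pr: "p \<in> set (P i)" "r \<in> set (P j)"
      and ij: "i \<le> j" "j < l" and ne: "Suc i mod l \<noteq> j" "Suc j mod l \<noteq> i" for u v p r i j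
  proof (cases "even (j - i)")
    case True
    then obtain m where m: "j - i = 2 * m" by (elim evenE)
    \<comment> \<open>Otherwise \<open>i = 0\<close> and \<open>j = l - 1\<close>, which are
      consecutive across the wrap-around.\<close>
    have "j - i \<noteq> l - 1" using ij ne(2) l(1)
      by (cases "i = 0") auto
    then have "Suc m < half" using m ij two_half by linarith
    moreover have "r \<in> set (P (i + 2 * m))" using pr(2) m ij(1) by (metis le_add_diff_inverse)
    ultimately show ?thesis using apart_if_even_distance uv pr(1) by blast
  next
    case False
    then obtain m where m: "j - i = 2 * m + 1" by (elim oddE)
    then have "m \<noteq> 0" using ij ne(1) by (cases "m = 0") auto
    \<comment> \<open>For an odd difference the way on from \<open>j\<close> to \<open>i + l\<close>
      is used, whose length \<open>l - (2 * m + 1)\<close> is even.\<close>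
    have "p \<in> set (P (j + 2 * (half - 1 - m)))"
    proof -
      have "j + 2 * (half - 1 - m) = i + l" using m ij two_half by simp
      then show ?thesis using pr(1) P_period by metis
    qed
    moreover have "Suc (half - 1 - m) < half" using \<open>m \<noteq> 0\<close> two_half l(1) by linarith
    ultimately show ?thesis
      using apart_sym[OF apart_if_even_distance[OF uv(2,1) pr(2)]] by blast
  qed
  let ?i = "i mod l" and ?j = "j mod l"
  have i: "p \<in> set (P ?i)" "?i < l" and j: "r \<in> set (P ?j)" "?j < l"
    using assms(3,4) l(1) by (auto simp: P_mod)
  have "Suc ?i mod l \<noteq> ?j" "Suc ?j mod l \<noteq> ?i" using assms(5,6) by (simp_all add: mod_Suc_eq)
  then show ?thesis
    using ordered[OF assms(1,2) i(1) j(1)] apart_sym[OF ordered[OF assms(2,1) j(1) i(1)]] i(2) j(2)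
    by linarith
qed

section \<open>Pins in a ring of walls\<close>

text \<open>The conditions of a pin with \<open>sub_b\<close> and \<open>sub_c\<close> unfolded into
  statements about all links, so that each way of failing supplies a link. The index
  \<open>i + (l - 1)\<close> stands for \<open>i - 1\<close>.\<close>

definition pinned :: "nat \<Rightarrow> 'a \<Rightarrow> 'a \<Rightarrow> bool" where
  "pinned i x y \<longleftrightarrow> x \<in> set (P i) \<and> y \<in> set (P (Suc i)) \<and>
     (\<forall>e \<in> E (i + (l - 1)). \<not> before (P i) x (t e)) \<and>
     (\<forall>e \<in> E (Suc i). \<not> before (P (Suc i)) (s e) y) \<and>
     (\<forall>e \<in> E i. \<not> (before (P i) (s e) x \<and> before (P (Suc i)) y (t e)))"

lemma pinned_mod: "pinned (i mod l) x y \<longleftrightarrow> pinned i x y"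
proof -
  have "P (Suc (i mod l)) = P (Suc i)" "E (Suc (i mod l)) = E (Suc i)"
    by (rule P_cong, simp add: mod_Suc_eq) (rule E_cong, simp add: mod_Suc_eq)
  moreover have "E (i mod l + (l - 1)) = E (i + (l - 1))"
    by (rule E_cong) (rule mod_add_left_eq)
  ultimately show ?thesis unfolding pinned_def P_mod E_mod by simp
qed

text \<open>The link that violates a condition has \<open>x\<close> and \<open>y\<close> on its free
  path. A link from \<open>P (i - 1)\<close> ending after \<open>x\<close> has \<open>x\<close> on
  the last part of that path and \<open>P (Suc i)\<close> as its first full wall; a link from
  \<open>P (Suc i)\<close> starting before \<open>y\<close> has \<open>y\<close> on the first part
  and \<open>P i\<close> as its last full wall; in the third case \<open>x\<close> is on the first
  and \<open>y\<close> on the last part.\<close>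

lemma apart_if_not_pinned:
  assumes x: "x \<in> set (P i)" and y: "y \<in> set (P (Suc i))" and "\<not> pinned i x y"
  shows "apart x y"
proof -
  have half: "1 < half" using two_half l(1) by linarith
  consider e where "e \<in> E (i + (l - 1))" "before (P i) x (t e)"
    | e where "e \<in> E (Suc i)" "before (P (Suc i)) (s e) y"
    | e where "e \<in> E i" "before (P i) (s e) x" "before (P (Suc i)) y (t e)"
    using assms unfolding pinned_def by blast
  then show ?thesis
  proof cases
    case 1
    let ?n = "i + (l - 1)"
    have "Suc ?n = i + l" "?n + 2 * 1 = Suc i + l" using l(1) by simp_all
    then have P: "P (Suc ?n) = P i" "P (?n + 2 * 1) = P (Suc i)" by (metis P_period)+
    obtain cs ds where cs: "P i = cs @ t e # ds" "x \<in> set cs"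
      using before_split_snd[OF 1(2)] .
    obtain as bs where "P ?n = as @ s e # bs" using split_list[OF s_wall[OF 1(1)]] by blast
    moreover have "y \<in> set (walls_between ?n 1 half)"
      using in_walls_between[of y ?n 1 1 half] y P(2) half by simp
    ultimately show ?thesis
      using apart_if_link[OF 1(1) _ _ attached_refl attached_refl] cs P(1) by auto
  next
    case 2
    let ?n = "Suc i"
    have "?n + 2 * (half - 1) = i + l" using two_half half by simp
    then have P: "P (?n + 2 * (half - 1)) = P i" by (metis P_period)
    obtain as bs where as: "P ?n = as @ s e # bs" "y \<in> set bs"
      using before_split_fst[OF 2(2)] .
    obtain cs ds where "P (Suc ?n) = cs @ t e # ds" using split_list[OF t_wall[OF 2(1)]] by blast
    moreover have "x \<in> set (walls_between ?n 1 half)"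
      using in_walls_between[of x ?n "half - 1" 1 half] x half unfolding P by simp
    ultimately show ?thesis
      using apart_if_link[OF 2(1) _ _ attached_refl attached_refl] as by auto
  next
    case 3
    obtain as bs where "P i = as @ s e # bs" "x \<in> set bs"
      using before_split_fst[OF 3(2)] .
    moreover obtain cs ds where "P (Suc i) = cs @ t e # ds" "y \<in> set cs"
      using before_split_snd[OF 3(3)] .
    ultimately show ?thesis
      using apart_if_link[OF 3(1) _ _ attached_refl attached_refl] by auto
  qed
qed

text \<open>If \<open>n\<close> is \<open>j - 1\<close> or \<open>j + 1\<close>, then
  \<open>Suc n\<close> is \<open>j\<close> or \<open>j + 2\<close>. Neither is next to
  \<open>j\<close>, since 1 and 3 are nonzero modulo \<open>l\<close>.\<close>

lemma not_consecutive_or_next: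
  assumes "Suc n mod l = j mod l \<or> Suc j mod l = n mod l"
  shows "Suc (Suc n) mod l \<noteq> j mod l" "Suc j mod l \<noteq> Suc n mod l"
proof -
  have neq: "(j + a) mod l \<noteq> (j + b) mod l" if "a < b" "b < 5" for a b
    using that l(1) by (intro mod_l_neqI) auto
  have *: "Suc m mod l = k mod l \<Longrightarrow> Suc (Suc m) mod l = Suc k mod l" for m k
    by (metis mod_Suc_eq)
  show "Suc (Suc n) mod l \<noteq> j mod l"
  proof
    assume eq: "Suc (Suc n) mod l = j mod l"
    from assms show False
    proof
      assume "Suc n mod l = j mod l"
      with * have "Suc (Suc n) mod l = Suc j mod l" by blast
      with eq neq[of 0 1] show False by simp
    next
      assume "Suc j mod l = n mod l"
      then have "Suc (Suc n) mod l = (j + 3) mod l" by (metis * Suc_eq_plus1 add_Suc_right mod_Suc_eq numeral_3_eq_3 add_0_right)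
      with eq neq[of 0 3] show False by simp
    qed
  qed
  show "Suc j mod l \<noteq> Suc n mod l"
  proof
    assume eq: "Suc j mod l = Suc n mod l"
    from assms show False
    proof
      assume "Suc n mod l = j mod l"
      with eq neq[of 0 1] show False by simp
    next
      assume "Suc j mod l = n mod l"
      then have "Suc n mod l = (j + 2) mod l" by (metis mod_Suc_eq add_2_eq_Suc')
      with eq neq[of 1 2] show False by simp
    qed
  qed
qed

text \<open>
  An internal vertex of a link can be replaced by either end of the link, and one of these ends
  does not lie on a wall consecutive to a given one.
\<close>

lemma apart_link_wall:
  assumes e: "e \<in> E n" "u \<in> set (I e)" and v: "attached v r" "r \<in> set (P j)"
  shows "apart u v"
proof (cases "Suc n mod l = j mod l \<or> Suc j mod l = n mod l")
  case False
  have "attached u (s e)" using e unfolding attached_def by blast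
  then show ?thesis using apart_if_not_consecutive[OF _ v(1) s_wall[OF e(1)] v(2)] False by blast
next
  case True
  have "attached u (t e)" using e unfolding attached_def by blast
  then show ?thesis
    using apart_if_not_consecutive[OF _ v(1) t_wall[OF e(1)] v(2)] not_consecutive_or_next[OF True]
    by blast
qed

lemma wall_cases:
  assumes "u \<in> verts G"
  obtains n where "u \<in> set (P n)" | n e where "e \<in> E n" "u \<in> set (I e)"
  using assms unfolding verts by blast

lemma apart_or_pinned:
  assumes "u \<in> verts G" "v \<in> verts G" "\<not> apart u v"
  obtains i where "pinned i u v \<or> pinned i v u"
proof -
  have no_link: False if "e \<in> E n" "u \<in> set (I e)" "v \<in> verts G" "\<not> apart u v" for e n u v
  proof -
    \<comment> \<open>A vertex on a wall represents itself; one inside a link is represented by the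
      start of the link.\<close>
    have "\<exists>r j. attached v r \<and> r \<in> set (P j)"
      using \<open>v \<in> verts G\<close> s_wall attached_refl unfolding verts attached_def by blast
    then show False using apart_link_wall that by blast
  qed
  obtain i where i: "u \<in> set (P i)"
    using wall_cases[OF assms(1)] no_link[OF _ _ assms(2,3)] by blast
  have "\<not> apart v u" using apart_sym assms(3) by metis
  then obtain j where j: "v \<in> set (P j)"
    using wall_cases[OF assms(2)] no_link[OF _ _ assms(1) \<open>\<not> apart v u\<close>] by blast
  have "Suc i mod l = j mod l \<or> Suc j mod l = i mod l"
    using apart_if_not_consecutive[OF attached_refl attached_refl i j] assms(3) by blast
  then have "P (Suc i) = P j \<or> P (Suc j) = P i" using P_cong by blast
  then have "pinned i u v \<or> pinned j v u"
    using apart_if_not_pinned i j assms(3) \<open>\<not> apart v u\<close> by metis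
  then show ?thesis using that by blast
qed

subsection \<open>A rank function excluding dicycles\<close>

lemma ex_index_from: "\<exists>d<l. n mod l = (i + d) mod l"
proof (intro exI conjI)
  \<comment> \<open>The witness is \<open>n - i\<close> modulo \<open>l\<close>, written without
    subtraction of \<open>i\<close>.\<close>
  show "(n + (l - 1) * i) mod l < l" using l(1) by simp
  have "i + (n + (l - 1) * i) = n + l * i" using l(1) by (cases l) auto
  then show "n mod l = (i + (n + (l - 1) * i) mod l) mod l"
    by (metis mod_add_right_eq mod_mult_self2)
qed

text \<open>
  Along all arcs whose head is neither \<open>x\<close> nor \<open>y\<close>, the following rank increases: cut \<open>P i\<close> at
  \<open>x\<close> and \<open>P (Suc i)\<close> at \<open>y\<close>, and traverse first the two segments starting at \<open>x\<close> and \<open>y\<close>, then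
  the remaining walls, and finally the two segments ending before \<open>x\<close> and \<open>y\<close>.
\<close>

lemma rank_if_pinned:
  assumes "pinned i x y"
  obtains rank :: "'a \<Rightarrow> nat"
  where "\<And>a b. a \<rightarrow>\<^bsub>G\<^esub> b \<Longrightarrow> b \<noteq> x \<Longrightarrow> b \<noteq> y \<Longrightarrow> rank a < rank b"
proof -
  interpret G: fin_digraph G by (rule fin)
  obtain kx where kx: "kx < length (P i)" "x = P i ! kx"
    using assms unfolding pinned_def by (metis in_set_conv_nth)
  obtain ky where ky: "ky < length (P (Suc i))" "y = P (Suc i) ! ky"
    using assms unfolding pinned_def by (metis in_set_conv_nth)
  have into_x: "k \<le> kx" if "e \<in> E (i + (l - 1))" "k < length (P i)" "P i ! k = t e" for e k
    using assms that before_nth_iff[OF P_distinct kx(1) that(2)] kx(2)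
    unfolding pinned_def by (metis not_le_imp_less)
  have from_y: "ky \<le> k" if "e \<in> E (Suc i)" "k < length (P (Suc i))" "P (Suc i) ! k = s e" for e k
    using assms that before_nth_iff[OF P_distinct that(2) ky(1)] ky(2)
    unfolding pinned_def by (metis not_le_imp_less)
  have x_to_y: "k' \<le> ky" if "e \<in> E i" "k < kx" "P i ! k = s e"
    "k' < length (P (Suc i))" "P (Suc i) ! k' = t e" for e k k'
    using assms that before_nth_iff[OF P_distinct ky(1) that(4)] ky(2)
      before_nth_iff[OF P_distinct less_trans[OF that(2) kx(1)] kx(1)] kx(2)
    unfolding pinned_def by (metis not_le_imp_less)
  define N where "N = card (verts G)"
  have P_len: "length (P n) \<le> N" for n
  proof -
    have "set (P n) \<subseteq> verts G" unfolding verts by auto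
    then show ?thesis
      unfolding N_def using distinct_card[OF P_distinct[of n]] card_mono[OF G.finite_verts] by metis
  qed
  have I_len: "length (I e) \<le> N" if "e \<in> E n" for e n
  proof -
    have "set (I e) \<subseteq> verts G" using that unfolding verts by auto
    then show ?thesis
      unfolding N_def using distinct_card[OF I_distinct[OF that]] card_mono[OF G.finite_verts] by metis
  qed
  \<comment> \<open>The blocks are numbered in the order of traversal, with \<open>d\<close> the
    distance from wall \<open>P i\<close>. The parts before \<open>x\<close> and \<open>y\<close>
    get the numbers \<open>l\<close> and \<open>l + 1\<close>, as if the ring were unrolled one
    round further.\<close>
  define block where "block d k =
    (if d = 0 then if k < kx then l else 0 else if d = 1 then if k < ky then l + 1 else 1 else d)"
    for d k
  \<comment> \<open>Offsets inside a block: wall vertices use the values below \<open>N\<close>,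
    vertices inside links starting in the block use those from \<open>N\<close> to
    \<open>2 * N - 1\<close>. So a link rises above its start before it leaves the block.\<close>
  define M where "M = 2 * N"
  \<comment> \<open>Wall and link vertices need different formulas, so the rank begins as a
    relation; the injectivity facts below make it single-valued.\<close>
  define R where "R z n \<longleftrightarrow>
      (\<exists>d<l. \<exists>k<length (P (i + d)). z = P (i + d) ! k \<and> n = block d k * M + k) \<or>
      (\<exists>d<l. \<exists>e\<in>E (i + d). \<exists>k<length (P (i + d)). \<exists>j<length (I e).
         s e = P (i + d) ! k \<and> z = I e ! j \<and> n = block d k * M + N + j)" for z n
  have index_inj: "d = d'" if "(i + d) mod l = (i + d') mod l" "d < l" "d' < l" for d d'
    using that mod_l_neqI[of "i + d" "i + d'"] mod_l_neqI[of "i + d'" "i + d"]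
    by (cases d d' rule: linorder_cases) auto
  have wall_inj: "d = d' \<and> k = k'"
    if "d < l" "d' < l" "k < length (P (i + d))" "k' < length (P (i + d'))"
      "P (i + d) ! k = P (i + d') ! k'" for d d' k k'
  proof -
    have "d = d'" using that in_P_unique index_inj by (metis nth_mem)
    then show ?thesis using that P_distinct by (simp add: nth_eq_iff_index_eq)
  qed
  have link_inj: "d = d' \<and> k = k' \<and> j = j'"
    if "d < l" "e \<in> E (i + d)" "k < length (P (i + d))" "s e = P (i + d) ! k" "j < length (I e)"
      "d' < l" "e' \<in> E (i + d')" "k' < length (P (i + d'))" "s e' = P (i + d') ! k'"
      "j' < length (I e')" "I e ! j = I e' ! j'" for d d' k k' j j' e e'
  proof -
    have "e = e'" using that I_disjoint by (metis disjoint_iff nth_mem)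
    then show ?thesis
      using that wall_inj[of d d' k k'] I_distinct by (auto simp: nth_eq_iff_index_eq)
  qed
  have wall_link: "P m ! k \<noteq> I e ! j"
    if "k < length (P m)" "e \<in> E n" "j < length (I e)" for m n k j e
    using that I_wall by (metis disjoint_iff nth_mem)
  have R_unique: "n = n'" if "R z n" "R z n'" for z n n'
    using that unfolding R_def
    by (elim disjE exE conjE bexE) (metis wall_inj, metis wall_link, metis wall_link, metis link_inj)
  define rank where "rank z = (THE n. R z n)" for z
  have rank: "rank z = n" if "R z n" for z n
    unfolding rank_def using that R_unique by blast
  have rank_wall: "rank (P (i + d) ! k) = block d k * M + k"
    if "d < l" "k < length (P (i + d))" for d k
    using that by (intro rank) (auto simp: R_def)
  have rank_link: "rank (I e ! j) = block d k * M + N + j"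
    if "d < l" "e \<in> E (i + d)" "k < length (P (i + d))" "s e = P (i + d) ! k" "j < length (I e)"
    for d e k j
    using that unfolding R_def by (intro rank[unfolded R_def] disjI2) blast
  have block_less: "c * M + m < c' * M + m'" if "c < c'" "m < M" for c c' m m'
  proof -
    have "c * M + m < Suc c * M" using that(2) by simp
    also have "\<dots> \<le> c' * M" using that(1) by (intro mult_le_mono1) simp
    finally show ?thesis by simp
  qed
  have wrap: "P (i + (d + e)) = P (i + (d + e - l))" if "l \<le> d + e" for d e
    using that P_period[of "i + (d + e - l)"] by simp
  show ?thesis
  proof (rule that)
    fix a b assume ab: "a \<rightarrow>\<^bsub>G\<^esub> b" "b \<noteq> x" "b \<noteq> y"
    consider (wall) n k where "Suc k < length (P n)" "a = P n ! k" "b = P n ! Suc k"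
      | (skip) n where "a = last (P n)" "b = hd (P (n + 2))"
      | (link) n e j where "e \<in> E n" "j \<le> length (I e)" "a = (s e # I e) ! j" "b = (I e @ [t e]) ! j"
      using ab(1) unfolding dominates_iff by blast
    then show "rank a < rank b"
    proof cases
      case wall
      obtain d where d: "d < l" "n mod l = (i + d) mod l" using ex_index_from by blast
      note w = wall[unfolded P_cong[OF d(2)]]
      \<comment> \<open>A step along a wall changes the block only by entering \<open>x\<close> or
        \<open>y\<close>.\<close>
      have "d = 0 \<Longrightarrow> Suc k \<noteq> kx" "d = 1 \<Longrightarrow> Suc k \<noteq> ky"
        using w(3) ab(2,3) kx(2) ky(2) by auto
      then have "block d (Suc k) = block d k" unfolding block_def by simp linarith
      then show ?thesis using w d(1) rank_wall[of d k] rank_wall[of d "Suc k"] by simp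
    next
      case skip
      obtain d where d: "d < l" "n mod l = (i + d) mod l" using ex_index_from by blast
      define k where "k = length (P (i + d)) - 1"
      have k: "k < length (P (i + d))" "a = P (i + d) ! k"
        using skip(1) P_nonempty[of "i + d"] unfolding P_cong[OF d(2)] k_def
        by (simp_all add: last_conv_nth)
      have "(n + 2) mod l = (i + (d + 2)) mod l" using d(2) by (metis add.assoc mod_add_left_eq)
      then have b: "b = P (i + (d + 2)) ! 0"
        using skip(2) P_nonempty P_cong by (metis hd_conv_nth)
      \<comment> \<open>The last vertex of a wall is never before the cut, so the block is the plain
        distance \<open>d\<close>.\<close>
      have "block d k = (if d = 0 then 0 else d)"
        using kx(1) ky(1) unfolding block_def k_def by (auto simp: not_less)
      then have rank_a: "rank a = d * M + k" using rank_wall[OF d(1) k(1)] k(2) by (auto split: if_splits)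
      have "k < M" using k(1) P_len[of "i + d"] unfolding M_def by simp
      define d' where "d' = (if d + 2 < l then d + 2 else d + 2 - l)"
      have d': "d' < l" "b = P (i + d') ! 0"
        using d(1) l(1) b wrap[of d 2] unfolding d'_def by auto
      \<comment> \<open>A skip link entering one of the two cut walls ends in its first vertex,
        which is neither \<open>x\<close> nor \<open>y\<close> and hence lies before the cut, in
        block \<open>l\<close> or \<open>l + 1\<close>.\<close>
      have "d' = 0 \<Longrightarrow> kx \<noteq> 0" "d' = 1 \<Longrightarrow> ky \<noteq> 0"
        using d'(2) ab(2,3) kx(2) ky(2) by (auto intro!: gr0I)
      moreover have "d' = d + 2 \<or> d' = 0 \<or> d' = 1" using d(1) unfolding d'_def by auto
      ultimately have "d < block d' 0" using d(1) unfolding block_def by auto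
      then have "d * M + k < block d' 0 * M + 0" using \<open>k < M\<close> by (rule block_less)
      then show ?thesis
        using rank_a d'(2) rank_wall[OF d'(1), of 0] P_nonempty by simp
    next
      case link
      obtain d where d: "d < l" "n mod l = (i + d) mod l" using ex_index_from by blast
      have e: "e \<in> E (i + d)" using link(1) E_cong[OF d(2)] by simp
      obtain k where k: "k < length (P (i + d))" "s e = P (i + d) ! k"
        using s_wall[OF e] by (metis in_set_conv_nth)
      obtain m where m: "rank a = block d k * M + m" "m < M" "m < N + j"
      proof (cases j)
        case 0
        then show ?thesis
          using that[of k] link(3) k rank_wall[OF d(1) k(1)] P_len[of "i + d"] unfolding M_def by simp
      next
        case (Suc j')
        then show ?thesis
          using that[of "N + j'"] link(2,3) rank_link[OF d(1) e k, of j'] I_len[OF e]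
          unfolding M_def by simp
      qed
      show ?thesis
      proof (cases "j < length (I e)")
        case True
        then have "b = I e ! j" using link(4) by (simp add: nth_append)
        then have "rank b = block d k * M + N + j" using rank_link[OF d(1) e k True] by simp
        then show ?thesis using m by auto
      next
        case False
        then have b: "b = t e" using link(2,4) by (simp add: nth_append)
        define d' where "d' = (if d + 1 < l then d + 1 else 0)"
        have P_d': "P (Suc (i + d)) = P (i + d')"
          using wrap[of d 1] d(1) unfolding d'_def by auto
        obtain k' where k': "k' < length (P (i + d'))" "b = P (i + d') ! k'"
          using t_wall[OF e] b unfolding P_d' by (metis in_set_conv_nth)
        have "d' < l" using l(1) unfolding d'_def by simp
        \<comment> \<open>Here each condition of the pin is used once: links from before
          \<open>x\<close> must end before \<open>y\<close> (\<open>d = 0\<close>), links from the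
          wall of \<open>y\<close> start no earlier than \<open>y\<close> (\<open>d = 1\<close>),
          and links into the wall of \<open>x\<close> end before \<open>x\<close>
          (\<open>d = l - 1\<close>). All others go from block \<open>d\<close> to
          \<open>d + 1\<close>, or from block 0 to 1 or \<open>l + 1\<close>.\<close>
        have "block d k < block d' k'"
        proof -
          consider "d = 0" | "d = 1" | "2 \<le> d" "d + 1 < l" | "d = l - 1" using d(1) by linarith
          then show ?thesis
          proof cases
            case 1
            then have d'_1: "d' = 1" using l(1) unfolding d'_def by simp
            show ?thesis
            proof (cases "k < kx")
              case True
              then have "k' \<le> ky" using x_to_y[of e k k'] True e k k' b 1 d'_1 by simp
              moreover have "k' \<noteq> ky" using k' ab(3) ky d'_1 by auto
              ultimately show ?thesis using True 1 d'_1 unfolding block_def by simp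
            qed (use 1 d'_1 in \<open>simp add: block_def\<close>)
          next
            case 2
            then have "ky \<le> k" using from_y[of e k] e k by simp
            then show ?thesis using 2 l(1) unfolding block_def d'_def by simp
          next
            case 3
            then show ?thesis unfolding block_def d'_def by simp
          next
            case 4
            then have d'_0: "d' = 0" using l(1) unfolding d'_def by simp
            have "k' \<le> kx" using into_x[of e k'] e k' b d'_0 4 by simp
            moreover have "k' \<noteq> kx" using k' ab(2) kx d'_0 by auto
            ultimately show ?thesis using 4 d'_0 l(1) unfolding block_def by auto
          qed
        qed
        then have "block d k * M + m < block d' k' * M + k'" using m(2) by (rule block_less)
        then show ?thesis using m(1) k'(2) rank_wall[OF \<open>d' < l\<close> k'(1)] by simp
      qed
    qed
  qed
qed

end

section \<open>The ring of walls of a subdivided vault\<close>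

locale subdivided_vault = vault V for V :: "('a, 'c) vault_structure" +
  fixes L :: "'c \<Rightarrow> 'b awalk" and G :: "('a, 'b) pre_digraph"
  assumes sub: "subdivision_via (vault_graph V) L G"
begin

abbreviation "H \<equiv> vault_graph V"

abbreviation "inner e \<equiv> pre_digraph.inner_verts G (L e)"

sublocale H: fin_digraph H
  by (rule fin)

sublocale G: wf_digraph G
  using sub unfolding subdivision_via_def by simp

definition skip_arc :: "nat \<Rightarrow> 'c" where
  "skip_arc i = (THE e. e \<in> skip_arcs V i)"

text \<open>With the skip arc appended, the vertices of a wall are exactly the tails of these arcs,
  both in the vault and after subdivision: the vertex that \<open>sub_wall\<close> drops is the head
  of the last arc.\<close>

definition long_wall_arcs :: "nat \<Rightarrow> 'c list" where
  "long_wall_arcs i = wall_arcs V i @ [skip_arc i]"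

lemma step_less: "step V k i < num_walls V"
  using num_walls(1) unfolding step_def by simp

lemma link:
  assumes "e \<in> arcs H"
  shows "L e \<noteq> []" "G.awalk (tail H e) (L e) (head H e)" "distinct (inner e)"
    "set (inner e) \<inter> verts H = {}"
  using sub assms unfolding subdivision_via_def by auto

lemma inner_disjoint: "e \<in> arcs H \<Longrightarrow> f \<in> arcs H \<Longrightarrow> e \<noteq> f \<Longrightarrow> set (inner e) \<inter> set (inner f) = {}"
  using sub unfolding subdivision_via_def by auto

lemma map_tail_link:
  assumes "e \<in> arcs H"
  shows "map (tail G) (L e) = tail H e # inner e"
  using link(1,2)[OF assms] unfolding G.inner_verts_def
  by (cases "L e") (auto simp: G.awalk_Cons_iff)

lemma map_head_link:
  assumes "e \<in> arcs H"
  shows "map (head G) (L e) = inner e @ [head H e]"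
  using G.awalk_map_head[OF link(2,1)[OF assms]] map_tail_link[OF assms] by simp

lemma skip_arc: "i < num_walls V \<Longrightarrow> e \<in> skip_arcs V i \<longleftrightarrow> e = skip_arc i"
  using skip_arcs unfolding skip_arc_def by (metis the_equality)

lemma skip_arc_ends:
  assumes "i < num_walls V"
  shows "skip_arc i \<in> arcs H" "tail H (skip_arc i) = wall_last V i"
    "head H (skip_arc i) = wall_first V (step V 2 i)"
  using skip_arc[OF assms, of "skip_arc i"] unfolding skip_arcs_def by auto

lemma wall_awalk: "i < num_walls V \<Longrightarrow> H.awalk (wall_first V i) (wall_arcs V i) (wall_last V i)"
  using wall_path unfolding H.apath_def by simp

lemma distinct_wall_verts: "i < num_walls V \<Longrightarrow> distinct (wall_verts V i)"
  using wall_path unfolding H.apath_def wall_verts_def by simp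

lemma long_wall_awalk:
  assumes "i < num_walls V"
  shows "H.awalk (wall_first V i) (long_wall_arcs i) (wall_first V (step V 2 i))"
proof -
  have "H.awalk (wall_last V i) [skip_arc i] (wall_first V (step V 2 i))"
    using H.arc_implies_awalk[OF skip_arc_ends(1)[OF assms]] skip_arc_ends(2,3)[OF assms] by simp
  with wall_awalk[OF assms] show ?thesis
    unfolding long_wall_arcs_def by (rule H.awalk_appendI)
qed

lemma long_wall_arcs_subset: "i < num_walls V \<Longrightarrow> set (long_wall_arcs i) \<subseteq> arcs H"
  using long_wall_awalk by auto

lemma map_tail_long_wall_arcs:
  assumes "i < num_walls V"
  shows "map (tail H) (long_wall_arcs i) = wall_verts V i"
proof (cases "wall_arcs V i = []")
  case True
  then show ?thesis
    using skip_arc_ends(2)[OF assms] unfolding long_wall_arcs_def wall_last_def wall_verts_def by simp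
next
  case False
  then show ?thesis
    using skip_arc_ends(2)[OF assms] unfolding long_wall_arcs_def wall_last_def wall_verts_def
    by (simp add: H.awalk_verts_conv)
qed

lemma subdivided_awalk:
  assumes "H.awalk a es b" "es \<noteq> []"
  shows "G.awalk a (concat (map L es)) b"
  using assms
proof (induction es arbitrary: a)
  case (Cons e es)
  then have e: "e \<in> arcs H" "a = tail H e" "H.awalk (head H e) es b"
    by (auto simp: H.awalk_Cons_iff)
  show ?case
  proof (cases "es = []")
    case True
    then show ?thesis using e link(2)[OF e(1)] by (auto simp: H.awalk_Nil_iff)
  next
    case False
    then have "G.awalk (head H e) (concat (map L es)) b" using Cons.IH e(3) by blast
    then show ?thesis using link(2)[OF e(1)] e(2) by (auto intro: G.awalk_appendI)
  qed
qed simp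

section \<open>Vertices on the walls of the subdivision\<close>

lemma sub_wall_conv:
  assumes "i < num_walls V"
  shows "sub_wall V L G i = map (tail G) (concat (map L (long_wall_arcs i)))"
proof -
  have "concat (map L (long_wall_arcs i)) \<noteq> []"
    using link(1)[OF skip_arc_ends(1)[OF assms]] unfolding long_wall_arcs_def by simp
  then have "butlast (G.awalk_verts (wall_first V i) (concat (map L (long_wall_arcs i)))) =
      map (tail G) (concat (map L (long_wall_arcs i)))"
    by (simp only: G.awalk_verts_conv if_False butlast_snoc)
  then show ?thesis unfolding sub_wall_def long_wall_arcs_def skip_arc_def .
qed

lemma sub_wall_concat:
  assumes "i < num_walls V"
  shows "sub_wall V L G i = concat (map (\<lambda>e. tail H e # inner e) (long_wall_arcs i))"
proof -
  have "map (\<lambda>e. map (tail G) (L e)) (long_wall_arcs i) =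
      map (\<lambda>e. tail H e # inner e) (long_wall_arcs i)"
    using map_tail_link long_wall_arcs_subset[OF assms] by (intro map_cong) auto
  then show ?thesis unfolding sub_wall_conv[OF assms] map_concat map_map comp_def by (rule arg_cong)
qed

lemma set_sub_wall:
  assumes "i < num_walls V"
  shows "set (sub_wall V L G i) = set (wall_verts V i) \<union> (\<Union>e \<in> set (long_wall_arcs i). set (inner e))"
  unfolding sub_wall_concat[OF assms] map_tail_long_wall_arcs[OF assms, symmetric] by auto

lemma wall_verts_subset: "i < num_walls V \<Longrightarrow> set (wall_verts V i) \<subseteq> verts H"
  using verts by auto

lemma wall_first_in: "i < num_walls V \<Longrightarrow> wall_first V i \<in> set (wall_verts V i)"
  using wall_awalk H.hd_in_awalk_verts(1) unfolding wall_verts_def by blast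

lemma long_wall_arcs_tail:
  "i < num_walls V \<Longrightarrow> e \<in> set (long_wall_arcs i) \<Longrightarrow> tail H e \<in> set (wall_verts V i)"
  using map_tail_long_wall_arcs by (metis image_eqI set_map)

lemma distinct_sub_wall:
  assumes i: "i < num_walls V"
  shows "distinct (sub_wall V L G i)"
  unfolding sub_wall_concat[OF i]
proof (rule distinct_concat_map)
  have tails: "distinct (map (tail H) (long_wall_arcs i))"
    unfolding map_tail_long_wall_arcs[OF i] by (rule distinct_wall_verts[OF i])
  then show "distinct (long_wall_arcs i)" by (simp add: distinct_map)
  show "distinct (tail H e # inner e)" if "e \<in> set (long_wall_arcs i)" for e
  proof -
    have "e \<in> arcs H" using that long_wall_arcs_subset[OF i] by auto
    then show ?thesis using link(3,4) H.tail_in_verts by fastforce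
  qed
  show "set (tail H e # inner e) \<inter> set (tail H f # inner f) = {}"
    if ef: "e \<in> set (long_wall_arcs i)" "f \<in> set (long_wall_arcs i)" "e \<noteq> f" for e f
  proof -
    have arcs: "e \<in> arcs H" "f \<in> arcs H" using ef long_wall_arcs_subset[OF i] by auto
    have "tail H e \<noteq> tail H f" using tails ef by (auto simp: distinct_map inj_on_def)
    moreover have "tail H f \<notin> set (inner e)" "tail H e \<notin> set (inner f)"
      using link(4) H.tail_in_verts arcs by blast+
    ultimately show ?thesis using inner_disjoint[OF arcs ef(3)] by auto
  qed
qed

lemma sub_wall_nonempty: "i < num_walls V \<Longrightarrow> sub_wall V L G i \<noteq> []"
  using set_sub_wall wall_first_in by (metis UnI1 empty_iff empty_set)

lemma hd_sub_wall:
  assumes "i < num_walls V"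
  shows "hd (sub_wall V L G i) = wall_first V i"
proof (cases "long_wall_arcs i")
  case Nil
  then show ?thesis unfolding long_wall_arcs_def by simp
next
  case (Cons e es)
  then show ?thesis
    using long_wall_awalk[OF assms] unfolding sub_wall_concat[OF assms] by (auto simp: H.awalk_Cons_iff)
qed

lemma cross_arc:
  assumes "e \<in> cross_arcs V i"
  shows "e \<in> arcs H" "tail H e \<in> set (wall_verts V i)" "head H e \<in> set (wall_verts V (step V 1 i))"
  using assms unfolding cross_arcs_def by auto

lemma wall_unique:
  "z \<in> set (wall_verts V i) \<Longrightarrow> z \<in> set (wall_verts V j) \<Longrightarrow> i < num_walls V \<Longrightarrow> j < num_walls V \<Longrightarrow> i = j"
  using walls_disjoint by blast

lemma step_neq:
  assumes "i < num_walls V"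
  shows "step V 1 i \<noteq> i" "step V 1 i \<noteq> step V 2 i"
  using assms num_walls(1) unfolding step_def by (auto simp: mod_Suc)

text \<open>\<open>cross_arcs\<close> is given by the ends of arcs alone, so wall and skip arcs have
  to be excluded. Those starting on wall \<open>i\<close> end on wall \<open>i\<close> or wall
  \<open>i + 2\<close>, and neither is wall \<open>i + 1\<close>.\<close>

lemma cross_arc_not_long_wall:
  assumes i: "i < num_walls V" and j: "j < num_walls V" and e: "e \<in> cross_arcs V i"
  shows "e \<notin> set (long_wall_arcs j)"
proof
  assume e': "e \<in> set (long_wall_arcs j)"
  then have "i = j" using wall_unique long_wall_arcs_tail[OF j e'] cross_arc(2)[OF e] i j by blast
  have "head H e \<in> set (wall_verts V i) \<or> head H e \<in> set (wall_verts V (step V 2 i))"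
  proof (cases "e \<in> set (wall_arcs V i)")
    case True
    then show ?thesis
      using H.awalk_verts_arc2[OF wall_awalk[OF i]] unfolding wall_verts_def by blast
  next
    case False
    then show ?thesis
      using e' \<open>i = j\<close> skip_arc_ends(3)[OF i] wall_first_in[OF step_less]
      unfolding long_wall_arcs_def by auto
  qed
  then show False
    using wall_unique[OF cross_arc(3)[OF e]] step_neq[OF i] i step_less by blast
qed

lemma arcs_cases:
  assumes "e \<in> arcs H"
  obtains i where "i < num_walls V" "e \<in> set (long_wall_arcs i)"
    | i where "i < num_walls V" "e \<in> cross_arcs V i"
proof -
  have "admissible_arcs V i \<subseteq> cross_arcs V i" for i
    unfolding admissible_arcs_def cross_arcs_def subpath_def by auto
  then show ?thesis
    using assms that skip_arc unfolding arcs long_wall_arcs_def by fastforce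
qed

lemma cross_arcs_nonempty: "i < num_walls V \<Longrightarrow> cross_arcs V i \<noteq> {}"
  using admissible_arcs unfolding admissible_arcs_def cross_arcs_def subpath_def by fastforce

lemma sub_walls_disjoint:
  assumes "i < num_walls V" "j < num_walls V" "i \<noteq> j"
  shows "set (sub_wall V L G i) \<inter> set (sub_wall V L G j) = {}"
proof -
  have "set (wall_verts V i) \<inter> set (wall_verts V j) = {}" using walls_disjoint assms by blast
  moreover have "set (wall_verts V k) \<inter> set (inner e) = {}"
    if "k < num_walls V" "e \<in> arcs H" for e k
    using link(4)[OF that(2)] wall_verts_subset[OF that(1)] by blast
  moreover have "set (inner e) \<inter> set (inner f) = {}"
    if "e \<in> set (long_wall_arcs i)" "f \<in> set (long_wall_arcs j)" for e f
  proof (rule inner_disjoint)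
    show "e \<noteq> f"
      using that long_wall_arcs_tail assms wall_unique by metis
  qed (use that long_wall_arcs_subset assms in blast)+
  ultimately show ?thesis
    unfolding set_sub_wall[OF assms(1)] set_sub_wall[OF assms(2)]
    using long_wall_arcs_subset[OF assms(1)] long_wall_arcs_subset[OF assms(2)] assms(1,2)
    by blast
qed

lemma fin_digraph_G: "fin_digraph G"
proof
  show "finite (verts G)"
    using sub H.finite_verts H.finite_arcs unfolding subdivision_via_def by auto
  show "finite (arcs G)"
    using sub H.finite_arcs unfolding subdivision_via_def by auto
qed

section \<open>Arcs of the subdivision along walls and links\<close>

lemma arcs_G: "arcs G = (\<Union>e \<in> arcs H. set (L e))"
  using sub unfolding subdivision_via_def by simp

lemma verts_G: "verts G = verts H \<union> (\<Union>e \<in> arcs H. set (inner e))"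
  using sub unfolding subdivision_via_def by simp

text \<open>The list of heads is the list of tails shifted by one, with the first vertex of wall
  \<open>i + 2\<close> put at the end. So the last index gives the arc to the next wall and all
  others give consecutive wall vertices.\<close>

lemma dominates_long_wall_iff:
  assumes i: "i < num_walls V"
  defines "P \<equiv> sub_wall V L G i"
  shows "(\<exists>e \<in> set (long_wall_arcs i). \<exists>f \<in> set (L e). x = tail G f \<and> y = head G f) \<longleftrightarrow>
    (\<exists>k. Suc k < length P \<and> x = P ! k \<and> y = P ! Suc k) \<or>
    (x = last P \<and> y = hd (sub_wall V L G (step V 2 i)))"
proof -
  define fs where "fs = concat (map L (long_wall_arcs i))"
  have P: "map (tail G) fs = P" unfolding P_def sub_wall_conv[OF i] fs_def ..
  have "P \<noteq> []" unfolding P_def by (rule sub_wall_nonempty[OF i])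
  have awalk: "G.awalk (wall_first V i) fs (wall_first V (step V 2 i))"
    unfolding fs_def using long_wall_awalk[OF i]
    by (rule subdivided_awalk) (simp add: long_wall_arcs_def)
  have heads: "map (head G) fs = tl P @ [hd (sub_wall V L G (step V 2 i))]"
    using G.awalk_map_head[OF awalk] P \<open>P \<noteq> []\<close> hd_sub_wall[OF step_less] by (metis map_is_Nil_conv)
  have len: "length fs = length P" using P by (metis length_map)
  have "(\<exists>e \<in> set (long_wall_arcs i). \<exists>f \<in> set (L e). x = tail G f \<and> y = head G f) \<longleftrightarrow>
      (\<exists>f \<in> set fs. x = tail G f \<and> y = head G f)"
    unfolding fs_def by auto
  also have "\<dots> \<longleftrightarrow> (\<exists>k < length fs. x = map (tail G) fs ! k \<and> y = map (head G) fs ! k)"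
    by (rule bex_set_iff_nth)
  also have "\<dots> \<longleftrightarrow> (\<exists>k < length P. x = P ! k \<and> y = (tl P @ [hd (sub_wall V L G (step V 2 i))]) ! k)"
    unfolding P heads len ..
  also have "\<dots> \<longleftrightarrow> (\<exists>k. Suc k < length P \<and> x = P ! k \<and> y = P ! Suc k) \<or>
    (x = last P \<and> y = hd (sub_wall V L G (step V 2 i)))" (is "?l \<longleftrightarrow> ?r")
  proof
    assume ?l
    then obtain k where k: "k < length P" "x = P ! k"
      "y = (tl P @ [hd (sub_wall V L G (step V 2 i))]) ! k" by blast
    show ?r
    proof (cases "Suc k < length P")
      case True
      then show ?thesis using k by (auto simp: nth_append nth_tl)
    next
      case False
      then have "k = length P - 1" using k(1) by simp
      then show ?thesis using k \<open>P \<noteq> []\<close> by (simp add: nth_append last_conv_nth)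
    qed
  next
    assume ?r
    then show ?l
    proof
      assume "\<exists>k. Suc k < length P \<and> x = P ! k \<and> y = P ! Suc k"
      then obtain k where "Suc k < length P" "x = P ! k" "y = P ! Suc k" by blast
      then show ?l by (intro exI[of _ k]) (auto simp: nth_append nth_tl)
    next
      assume "x = last P \<and> y = hd (sub_wall V L G (step V 2 i))"
      then show ?l using \<open>P \<noteq> []\<close>
        by (intro exI[of _ "length P - 1"]) (auto simp: nth_append last_conv_nth)
    qed
  qed
  finally show ?thesis .
qed

lemma dominates_cross_iff:
  assumes "e \<in> arcs H"
  shows "(\<exists>f \<in> set (L e). x = tail G f \<and> y = head G f) \<longleftrightarrow>
    (\<exists>k \<le> length (inner e). x = (tail H e # inner e) ! k \<and> y = (inner e @ [head H e]) ! k)"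
proof -
  have len: "length (L e) = Suc (length (inner e))"
    using map_tail_link[OF assms] by (metis length_Cons length_map)
  have "(\<exists>f \<in> set (L e). x = tail G f \<and> y = head G f) \<longleftrightarrow>
      (\<exists>k < length (L e). x = map (tail G) (L e) ! k \<and> y = map (head G) (L e) ! k)"
    by (rule bex_set_iff_nth)
  then show ?thesis
    unfolding map_tail_link[OF assms] map_head_link[OF assms] len less_Suc_eq_le .
qed

section \<open>The subdivided vault as a ring of walls\<close>

abbreviation "wall n \<equiv> sub_wall V L G (n mod num_walls V)"

abbreviation "links n \<equiv> cross_arcs V (n mod num_walls V)"

lemma step_mod: "step V k (n mod num_walls V) = (n + k) mod num_walls V"
  unfolding step_def by (rule mod_add_left_eq)

lemma mod_num_walls_less: "n mod num_walls V < num_walls V"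
  using num_walls(1) by simp

lemma dominates_iff_ring:
  "x \<rightarrow>\<^bsub>G\<^esub> y \<longleftrightarrow>
    (\<exists>n k. Suc k < length (wall n) \<and> x = wall n ! k \<and> y = wall n ! Suc k) \<or>
    (\<exists>n. x = last (wall n) \<and> y = hd (wall (n + 2))) \<or>
    (\<exists>n. \<exists>e \<in> links n. \<exists>k \<le> length (inner e).
       x = (tail H e # inner e) ! k \<and> y = (inner e @ [head H e]) ! k)" (is "_ \<longleftrightarrow> ?r")
proof -
  let ?Q = "\<lambda>e. \<exists>f \<in> set (L e). x = tail G f \<and> y = head G f"
  have "x \<rightarrow>\<^bsub>G\<^esub> y \<longleftrightarrow> (\<exists>e \<in> arcs H. ?Q e)"
    unfolding arcs_ends_conv arcs_G by auto
  also have "\<dots> \<longleftrightarrow> (\<exists>n. \<exists>e \<in> set (long_wall_arcs (n mod num_walls V)). ?Q e) \<or>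
      (\<exists>n. \<exists>e \<in> links n. ?Q e)" (is "?a \<longleftrightarrow> ?b")
  proof
    assume ?a
    then obtain e where e: "e \<in> arcs H" "?Q e" by blast
    from e(1) show ?b
    proof (cases rule: arcs_cases)
      case (1 i)
      then have "e \<in> set (long_wall_arcs (i mod num_walls V))" by simp
      then show ?thesis using e(2) by blast
    next
      case (2 i)
      then have "e \<in> links i" by simp
      then show ?thesis using e(2) by blast
    qed
  next
    assume ?b
    then show ?a using long_wall_arcs_subset[OF mod_num_walls_less] cross_arc(1) by blast
  qed
  also have "\<dots> \<longleftrightarrow> ?r"
  proof -
    have "(\<exists>e \<in> links n. ?Q e) \<longleftrightarrow> (\<exists>e \<in> links n. \<exists>k \<le> length (inner e).
       x = (tail H e # inner e) ! k \<and> y = (inner e @ [head H e]) ! k)" for n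
      using dominates_cross_iff cross_arc(1) by (intro bex_cong) auto
    then show ?thesis
      unfolding dominates_long_wall_iff[OF mod_num_walls_less] step_mod by blast
  qed
  finally show ?thesis .
qed

sublocale ring: wall_ring G "num_walls V" wall links "tail H" "head H" inner
proof
  show "finite (verts G)" "finite (arcs G)"
    using fin_digraph_G by (auto simp: fin_digraph_def fin_digraph_axioms_def)
  show "wall n \<noteq> []" "distinct (wall n)" "links n \<noteq> {}" for n
    using sub_wall_nonempty distinct_sub_wall cross_arcs_nonempty mod_num_walls_less by blast+
  show "set (wall m) \<inter> set (wall n) = {}" if "m mod num_walls V \<noteq> n mod num_walls V" for m n
    using sub_walls_disjoint[OF mod_num_walls_less mod_num_walls_less that] .
  show "tail H e \<in> set (wall n)" if "e \<in> links n" for e n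
    using cross_arc(2)[OF that] set_sub_wall[OF mod_num_walls_less] by blast
  show "head H e \<in> set (wall (Suc n))" if "e \<in> links n" for e n
    using cross_arc(3)[OF that] set_sub_wall[OF mod_num_walls_less] unfolding step_mod by auto
  show "distinct (inner e)" if "e \<in> links n" for e n
    using link(3) cross_arc(1)[OF that] .
  show "set (inner e) \<inter> set (wall m) = {}" if "e \<in> links n" for e m n
  proof -
    have "set (inner e) \<inter> set (inner f) = {}" if "f \<in> set (long_wall_arcs (m mod num_walls V))" for f
      using inner_disjoint[OF cross_arc(1)[OF \<open>e \<in> links n\<close>]] long_wall_arcs_subset[OF mod_num_walls_less]
        cross_arc_not_long_wall[OF mod_num_walls_less mod_num_walls_less \<open>e \<in> links n\<close>] that by blast
    moreover have "set (inner e) \<inter> set (wall_verts V (m mod num_walls V)) = {}"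
      using link(4)[OF cross_arc(1)[OF that]] wall_verts_subset[OF mod_num_walls_less] by blast
    ultimately show ?thesis unfolding set_sub_wall[OF mod_num_walls_less] by blast
  qed
  show "set (inner e) \<inter> set (inner f) = {}" if "e \<in> links m" "f \<in> links n" "e \<noteq> f" for e f m n
    using inner_disjoint cross_arc(1)[OF that(1)] cross_arc(1)[OF that(2)] that(3) .
  show "verts G = (\<Union>n. set (wall n) \<union> (\<Union>e \<in> links n. set (inner e)))" (is "_ = ?r")
  proof
    show "verts G \<subseteq> ?r"
    proof
      fix z assume "z \<in> verts G"
      then consider i where "i < num_walls V" "z \<in> set (wall_verts V i)"
        | e where "e \<in> arcs H" "z \<in> set (inner e)"
        unfolding verts_G verts by blast
      then show "z \<in> ?r"
      proof cases
        case (1 i)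
        then have "z \<in> set (wall i)" using set_sub_wall by simp
        then show ?thesis by blast
      next
        case (2 e)
        from 2(1) show ?thesis
        proof (cases rule: arcs_cases)
          case (1 i)
          then have "z \<in> set (wall i)" using set_sub_wall 2(2) by auto
          then show ?thesis by blast
        next
          case (2 i)
          then have "e \<in> links i" by simp
          then show ?thesis using \<open>z \<in> set (inner e)\<close> by blast
        qed
      qed
    qed
    show "?r \<subseteq> verts G"
    proof (rule UN_least)
      fix n
      have "set (wall n) \<subseteq> verts G"
        unfolding set_sub_wall[OF mod_num_walls_less] verts_G
        using wall_verts_subset[OF mod_num_walls_less] long_wall_arcs_subset[OF mod_num_walls_less]
        by fast
      moreover have "(\<Union>e \<in> links n. set (inner e)) \<subseteq> verts G"
        unfolding verts_G using cross_arc(1) by fast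
      ultimately show "set (wall n) \<union> (\<Union>e \<in> links n. set (inner e)) \<subseteq> verts G" by simp
    qed
  qed
  show "wall (n + num_walls V) = wall n" "links (n + num_walls V) = links n" for n
    by (simp_all only: mod_add_self2)
  show "x \<rightarrow>\<^bsub>G\<^esub> y \<longleftrightarrow>
    (\<exists>n k. Suc k < length (wall n) \<and> x = wall n ! k \<and> y = wall n ! Suc k) \<or>
    (\<exists>n. x = last (wall n) \<and> y = hd (wall (n + 2))) \<or>
    (\<exists>n. \<exists>e \<in> links n. \<exists>k \<le> length (inner e).
       x = (tail H e # inner e) ! k \<and> y = (inner e @ [head H e]) ! k)" for x y
    by (rule dominates_iff_ring)
qed (rule num_walls)+

lemma pin_iff_pinned:
  assumes "\<alpha> \<in> verts D - verts G" "ug_neighbor D u \<alpha>" "ug_neighbor D v \<alpha>"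
  shows "pin V L D G ({u, v}, \<alpha>) \<longleftrightarrow> (\<exists>i. ring.pinned i u v \<or> ring.pinned i v u)"
proof -
  define \<Phi> where "\<Phi> i x y \<longleftrightarrow> (let P = sub_wall V L G i; Q = sub_wall V L G (step V 1 i) in
        x \<in> subpath P (sub_b V L G i) (last P) \<and>
        y \<in> subpath Q (hd Q) (sub_c V L G (step V 1 i)) \<and>
        \<not> (\<exists>e \<in> cross_arcs V i. tail H e \<in> subpath P (hd P) x - {x} \<and>
             head H e \<in> subpath Q y (last Q) - {y}))" for i x y
  have main: "\<Phi> i x y \<longleftrightarrow> ring.pinned i x y"
    if i: "i < num_walls V" for i x y
  proof -
    let ?P = "wall i" and ?Q = "wall (Suc i)"
    have i_mod: "i mod num_walls V = i" using i by (rule mod_less)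
    have next_mod: "step V 1 i = Suc i mod num_walls V" unfolding step_def by simp
    have P: "sub_wall V L G i = ?P" "sub_wall V L G (step V 1 i) = ?Q"
      "cross_arcs V i = links i" "cross_arcs V (step V 1 i) = links (Suc i)"
      unfolding i_mod next_mod by (rule refl)+
    have prev: "cross_arcs V (step V (num_walls V - 1) i) = links (i + (num_walls V - 1))"
      unfolding step_def by (rule refl)
    have "Suc (i + (num_walls V - 1)) = i + num_walls V" using num_walls(1) by simp
    then have P_prev: "wall (Suc (i + (num_walls V - 1))) = ?P" by (simp only: ring.P_period)
    obtain e where e: "e \<in> links (i + (num_walls V - 1))" using ring.E_nonempty by blast
    then have "head H e \<in> set ?P" using ring.t_wall[OF e] unfolding P_prev by simp
    note b = before_last_filter_iff[of ?P "head H e"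
        "\<lambda>z. z \<in> head H ` links (i + (num_walls V - 1))", OF ring.P_distinct this imageI[OF e]]
    obtain f where f: "f \<in> links (Suc i)" using ring.E_nonempty by blast
    note c = before_hd_filter_iff[of ?Q "tail H f"
        "\<lambda>z. z \<in> tail H ` links (Suc i)", OF ring.P_distinct ring.s_wall[OF f] imageI[OF f]]
    \<comment> \<open>On a path, lying at or after the last link end means lying before no link end;
      this is where \<open>sub_b\<close> disappears.\<close>
    have x: "x \<in> subpath ?P (sub_b V L G i) (last ?P) \<longleftrightarrow>
        x \<in> set ?P \<and> (\<forall>e \<in> links (i + (num_walls V - 1)). \<not> before ?P x (head H e))"
      using subpath_to_last[OF b(1)] b before_in_set before_total before_asym[OF ring.P_distinct]
        before_irrefl[OF ring.P_distinct]
      unfolding sub_b_def P prev by (smt (verit) image_iff mem_Collect_eq)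
    have y: "y \<in> subpath ?Q (hd ?Q) (sub_c V L G (step V 1 i)) \<longleftrightarrow>
        y \<in> set ?Q \<and> (\<forall>e \<in> links (Suc i). \<not> before ?Q (tail H e) y)"
      using subpath_from_hd[OF c(1)] c before_in_set before_total before_asym[OF ring.P_distinct]
        before_irrefl[OF ring.P_distinct]
      unfolding sub_c_def P by (smt (verit) image_iff mem_Collect_eq)
    have "z \<in> subpath ?P (hd ?P) x - {x} \<longleftrightarrow> before ?P z x" if "x \<in> set ?P" for z
      using subpath_from_hd[OF that] before_irrefl[OF ring.P_distinct] by blast
    moreover have "z \<in> subpath ?Q y (last ?Q) - {y} \<longleftrightarrow> before ?Q y z" if "y \<in> set ?Q" for z
      using subpath_to_last[OF that] before_irrefl[OF ring.P_distinct] by blast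
    ultimately show ?thesis
      unfolding \<Phi>_def Let_def P x y ring.pinned_def by (simp del: Diff_iff cong: conj_cong) blast
  qed
  \<comment> \<open>\<open>ring.pinned\<close> takes any natural index; its periodicity reduces this
    to an index of a wall.\<close>
  have "(\<exists>i < num_walls V. \<Phi> i x y) \<longleftrightarrow> (\<exists>i. ring.pinned i x y)" for x y
    using mod_num_walls_less ring.pinned_mod main by metis
  moreover have "pin V L D G ({u, v}, \<alpha>) \<longleftrightarrow>
      (\<exists>x y. {u, v} = {x, y} \<and> (\<exists>i < num_walls V. \<Phi> i x y))"
    using assms unfolding pin_def \<Phi>_def by simp
  ultimately show ?thesis by (auto simp: doubleton_eq_iff)
qed

end

section \<open>Pins, transversals and clasps\<close>

lemma awalk_rank_less:
  fixes rank :: "'a \<Rightarrow> nat"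
  assumes "wf_digraph G" "\<And>e. e \<in> arcs G \<Longrightarrow> rank (tail G e) < rank (head G e)"
    and "pre_digraph.awalk G u p v" "p \<noteq> []"
  shows "rank u < rank v"
proof -
  interpret wf_digraph G by fact
  show ?thesis
    using assms(3,4)
  proof (induction p arbitrary: u)
    case (Cons e es)
    then have e: "rank u < rank (head G e)" "awalk (head G e) es v"
      using assms(2) by (auto simp: awalk_Cons_iff)
    show ?case
    proof (cases "es = []")
      case True
      then show ?thesis using e by (auto simp: awalk_Nil_iff)
    next
      case False
      then show ?thesis using e Cons.IH by fastforce
    qed
  qed simp
qed

text \<open>The vertices of a dicycle reach each other, so they lie in one strong component, which
  has at least two vertices and must be \<open>D'\<close>.\<close>

lemma (in wf_digraph) dicycle_in_big_scc:
  assumes sccs: "{C \<in> sccs. 1 < card (verts C)} = {D'}" and "finite (verts G)" and "dicycle G p"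
  shows "set p \<subseteq> arcs D'"
proof -
  obtain u where u: "awalk u p u" "distinct (tl (awalk_verts u p))" "2 \<le> length p"
    using \<open>dicycle G p\<close> unfolding dicycle_def cycle_def by blast
  have "u \<in> verts G" using u(1) by blast
  have in_scc: "set (awalk_verts u p) \<subseteq> scc_of u"
  proof
    fix z assume "z \<in> set (awalk_verts u p)"
    then obtain q r where "awalk u q z" "awalk z r u"
      using u(1) awalk_decomp by blast
    then show "z \<in> scc_of u" unfolding scc_of_def using reachable_awalkI by blast
  qed
  have "G \<restriction> scc_of u \<in> sccs"
    using in_verts_sccsD_sccs scc_of_in_sccs_verts[OF \<open>u \<in> verts G\<close>] by blast
  moreover have "1 < card (verts (G \<restriction> scc_of u))"
  proof -
    have "scc_of u \<subseteq> verts G" unfolding scc_of_def by (auto dest: reachable_in_verts)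
    then have "finite (scc_of u)" using \<open>finite (verts G)\<close> by (rule finite_subset)
    \<comment> \<open>The vertex list of the closed walk contains \<open>u\<close> at both ends;
      without its first entry it is distinct and has \<open>length p\<close> entries, at least 2 for
      a dicycle.\<close>
    moreover have "set (tl (awalk_verts u p)) \<subseteq> scc_of u"
      using in_scc by (cases "awalk_verts u p") auto
    ultimately have "card (set (tl (awalk_verts u p))) \<le> card (scc_of u)" by (rule card_mono)
    moreover have "card (set (tl (awalk_verts u p))) = length p"
      using distinct_card[OF u(2)] by (simp add: length_awalk_verts)
    ultimately show ?thesis using u(3) by simp
  qed
  ultimately have "G \<restriction> scc_of u \<in> {C \<in> sccs. 1 < card (verts C)}" by simp
  then have D': "D' = G \<restriction> scc_of u" unfolding sccs by simp
  show ?thesis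
  proof
    fix e assume "e \<in> set p"
    moreover have "set p \<subseteq> arcs G" using u(1) by (simp add: awalk_def)
    ultimately show "e \<in> arcs D'"
      using awalk_verts_arc1[of e p u] awalk_verts_arc2[OF u(1)] in_scc unfolding D' by auto
  qed
qed

text \<open>The dicycle of the clasp lies in \<open>D'\<close> and avoids the cycle through
  \<open>S\<close>, hence survives the deletion of \<open>S\<close>.\<close>

lemma not_transversal_if_clasp:
  assumes "fin_digraph D" and sccs: "{C \<in> pre_digraph.sccs D. 1 < card (verts C)} = {D'}"
    and "clasp k D D' (S, \<alpha>)"
  shows "\<not> dicycle_transversal D' S"
proof -
  interpret D: fin_digraph D by fact
  have "D' \<in> D.sccs" using sccs by blast
  then have sub: "subgraph D' D" by (auto simp: D.sccs_def induced_subgraph_def)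
  obtain vs es B where vs: "S \<union> {\<alpha>} \<subseteq> set vs" and B: "dicycle D B" "tail D ` set B \<inter> set vs = {}"
    using assms(3) unfolding clasp_def by auto
  have B_D': "set B \<subseteq> arcs D'"
    using D.dicycle_in_big_scc[OF sccs D.finite_verts B(1)] .
  interpret D': wf_digraph D' using sub by (simp add: subgraph_def)
  let ?H = "D' \<restriction> (verts D' - S)"
  have comp: "tail D = tail D'" "head D = head D'" using sub by (auto simp: subgraph_def compatible_def)
  obtain u where u: "D.awalk u B u" "distinct (tl (D.awalk_verts u B))" "B \<noteq> []" "2 \<le> length B"
    using B(1) unfolding dicycle_def D.cycle_def by blast
  have "u \<in> tail D ` set B" using u(1,3) by (cases B) (auto simp: D.awalk_Cons_iff)
  \<comment> \<open>\<open>clasp\<close> keeps only the tails of \<open>B\<close> off the cycle. As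
    \<open>B\<close> is closed, every head is also a tail, so no arc of \<open>B\<close> is
    lost.\<close>
  moreover have "head D ` set B \<subseteq> tail D ` set B"
  proof -
    have "set (map (head D) B) \<subseteq> set (map (tail D) B) \<union> {u}"
      unfolding D.awalk_map_head[OF u(1,3)] using list.set_sel(2)[of "map (tail D) B"] u(3) by auto
    then show ?thesis using \<open>u \<in> tail D ` set B\<close> by auto
  qed
  ultimately have "set B \<subseteq> arcs ?H" "u \<in> verts ?H"
    using B(2) B_D' vs comp by (auto simp: image_subset_iff)
  moreover have comp_H: "compatible ?H D" using comp by (simp add: compatible_def induce_subgraph_def)
  ultimately have "pre_digraph.awalk ?H u B u"
    using u(1) unfolding pre_digraph.awalk_def compatible_cas[OF comp_H] by blast
  then have "dicycle ?H B"
    using u(2-4) unfolding dicycle_def pre_digraph.cycle_def compatible_awalk_verts[OF comp_H] by blast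
  then show ?thesis unfolding dicycle_transversal_def by blast
qed

context subdivided_vault
begin

text \<open>Without \<open>x\<close> and \<open>y\<close>, every remaining arc raises the rank, so
  no nonempty walk can return to its start.\<close>

lemma transversal_if_pinned:
  assumes "ring.pinned i x y"
  shows "dicycle_transversal G {x, y}"
proof -
  obtain rank :: "'a \<Rightarrow> nat"
    where rank: "\<And>a b. a \<rightarrow>\<^bsub>G\<^esub> b \<Longrightarrow> b \<noteq> x \<Longrightarrow> b \<noteq> y \<Longrightarrow> rank a < rank b"
    using ring.rank_if_pinned[OF assms] by blast
  let ?H = "G \<restriction> (verts G - {x, y})"
  have wf: "wf_digraph ?H" by (rule G.wellformed_induce_subgraph)
  have "rank (tail ?H e) < rank (head ?H e)" if "e \<in> arcs ?H" for e
    using that G.in_arcs_imp_in_arcs_ends[of e] by (intro rank) auto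
  then have "\<not> pre_digraph.awalk ?H u p u" if "p \<noteq> []" for u p
    using awalk_rank_less[OF wf] that by blast
  then show ?thesis
    unfolding dicycle_transversal_def dicycle_def pre_digraph.cycle_def by blast
qed

text \<open>The dicycle is found inside \<open>W\<close> and the cycle outside it; \<alpha> is the
  only external vertex of the cycle, which gives the bound 1.\<close>

lemma clasp_if_apart:
  assumes "fin_digraph D" "subgraph G D" and uv: "u \<noteq> v" "ring.apart u v"
    and \<alpha>: "\<alpha> \<in> verts D - verts G" "ug_neighbor D u \<alpha>" "ug_neighbor D v \<alpha>"
  shows "clasp 1 D G ({u, v}, \<alpha>)"
proof -
  interpret D: fin_digraph D by fact
  have D: "arcs G \<subseteq> arcs D" "verts G \<subseteq> verts D" "tail D = tail G" "head D = head G"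
    using assms(2) by (auto simp: subgraph_def compatible_def)
  obtain W where W: "W \<subseteq> verts G" "W \<noteq> {}" "\<And>w. w \<in> W \<Longrightarrow> \<exists>w' \<in> W. w \<rightarrow>\<^bsub>G\<^esub> w'"
    "(u, v) \<in> (avoiding_edges G W)\<^sup>*"
    using uv(2) unfolding ring.apart_def by blast
  have "finite W"
    using W(1) fin_digraph.finite_verts[OF fin_digraph_G] by (rule finite_subset)
  then obtain B where B: "dicycle G B" "tail G ` set B \<subseteq> W"
    using dicycle_if_out_neighbors[OF G.wf_digraph _ W(2,1,3)] ring.loopfree by metis
  have "dicycle D B"
    using B(1) D.subgraph_cycle[OF assms(2)] unfolding dicycle_def by blast
  moreover obtain vs es where vs: "ug_cycle D vs es" "{u, v, \<alpha>} \<subseteq> set vs"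
    "set vs \<subseteq> insert \<alpha> (verts G - W)"
    using ug_cycle_if_connected[OF G.wf_digraph W(4) uv(1) D \<alpha>] by blast
  moreover have "card (set vs - verts G) \<le> 1"
  proof -
    have "card (set vs - verts G) \<le> card {\<alpha>}" using vs(3) by (intro card_mono) auto
    then show ?thesis by simp
  qed
  moreover have "tail D ` set B \<inter> set vs = {}"
    using B(2) vs(3) D(3) W(1) \<alpha>(1) by auto
  ultimately show ?thesis
    using \<alpha> unfolding clasp_def by auto
qed

end

theorem theorem6:
  fixes D D' :: "('a, 'b) pre_digraph"
    and V :: "('a, 'c) vault_structure"
    and L :: "'c \<Rightarrow> 'b awalk"
    and u v \<alpha> :: 'a
  assumes "fin_digraph D"
    and "{C \<in> pre_digraph.sccs D. 1 < card (verts C)} = {D'}"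
    and "vault V"
    and "\<not> has_niche V"
    and "subdivision_via (vault_graph V) L D'"
    and "u \<in> verts D'" and "v \<in> verts D'" and "u \<noteq> v"
    and "\<alpha> \<in> verts D - verts D'"
    and "ug_neighbor D u \<alpha>" and "ug_neighbor D v \<alpha>"
  shows "(pin V L D D' ({u, v}, \<alpha>) \<longleftrightarrow> dicycle_transversal D' {u, v}) \<and>
         (\<not> pin V L D D' ({u, v}, \<alpha>) \<longleftrightarrow> clasp 1 D D' ({u, v}, \<alpha>))"
proof -
  interpret subdivided_vault V L D'
    using assms(3,5) by (simp add: subdivided_vault_def subdivided_vault_axioms_def)
  have "D' \<in> pre_digraph.sccs D" using assms(2) by blast
  then have sub: "subgraph D' D" by (auto simp: pre_digraph.sccs_def induced_subgraph_def)
  note pin = pin_iff_pinned[OF assms(9-11)]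
  have "dicycle_transversal D' {u, v}" if p: "pin V L D D' ({u, v}, \<alpha>)"
  proof -
    obtain i where "ring.pinned i u v \<or> ring.pinned i v u" using p unfolding pin by blast
    then show ?thesis
      using transversal_if_pinned[of i u v] transversal_if_pinned[of i v u]
      by (auto simp: insert_commute)
  qed
  moreover have "clasp 1 D D' ({u, v}, \<alpha>)" if np: "\<not> pin V L D D' ({u, v}, \<alpha>)"
  proof (rule clasp_if_apart[OF assms(1) sub assms(8) _ assms(9-11)])
    show "ring.apart u v"
    proof (rule ccontr)
      assume "\<not> ring.apart u v"
      then obtain i where "ring.pinned i u v \<or> ring.pinned i v u"
        by (rule ring.apart_or_pinned[OF assms(6,7)])
      then show False using np unfolding pin by blast
    qed
  qed
  moreover have "\<not> dicycle_transversal D' {u, v}" if "clasp 1 D D' ({u, v}, \<alpha>)"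
    using not_transversal_if_clasp[OF assms(1,2) that] .
  ultimately show ?thesis by blast
qed

end
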